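(* Let $N,M\ge 1$ be integers and let $(q_{n,m})_{n,m\in\mathbb{Z}}$ be a real sequence that is $N,M$-periodic, i.e. $q_{n+N,m}=q_{n,m}$ and $q_{n,m+M}=q_{n,m}$ for all $n,m\in\mathbb{Z}$. Let $\mathcal{J}_1:\ell^2(\mathbb{Z}^2)\to\ell^2(\mathbb{Z}^2)$ be the discrete Schrödinger operator $$(\mathcal{J}_1y)_{n,m}=y_{n,m-1}+y_{n,m+1}+y_{n-1,m}+y_{n+1,m}+q_{n,m}y_{n,m},\qquad n,m\in\mathbb{Z}.$$ Then $$\mathrm{mes}(\sigma(\mathcal{J}_1))\le 4(N+M).$$
   Context: $\sigma(\cdot)$ denotes the spectrum and $\mathrm{mes}$ is Lebesgue measure on $\mathbb{R}$. *)

theory Defs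
  imports "HOL-Analysis.Analysis"
begin

subsection \<open>The complex Hilbert space of square-summable families\<close>

definition sq_summable :: "('a \<Rightarrow> complex) \<Rightarrow> bool" where
  "sq_summable f \<longleftrightarrow> (\<lambda>i. (cmod (f i))\<^sup>2) summable_on UNIV"

lemma sq_summable_0: "sq_summable (\<lambda>_. 0)"
  by (simp add: sq_summable_def)

lemma sq_summable_dominated:
  assumes "sq_summable f" "sq_summable g"
    and "\<And>i. (cmod (h i))\<^sup>2 \<le> c * (cmod (f i))\<^sup>2 + c * (cmod (g i))\<^sup>2"
  shows "sq_summable h"
  unfolding sq_summable_def
  by (rule summable_on_comparison_test
      [where f = "\<lambda>i. c * (cmod (f i))\<^sup>2 + c * (cmod (g i))\<^sup>2"])
    (use assms in \<open>auto simp: sq_summable_def intro!: summable_on_add summable_on_cmult_right\<close>)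

lemma sq_summable_add:
  assumes "sq_summable f" "sq_summable g"
  shows "sq_summable (\<lambda>i. f i + g i)"
proof (rule sq_summable_dominated[OF assms, where c = 2])
  fix i
  have "(cmod (f i + g i))\<^sup>2 \<le> (cmod (f i) + cmod (g i))\<^sup>2"
    by (simp add: norm_triangle_ineq power_mono)
  also have "\<dots> \<le> 2 * (cmod (f i))\<^sup>2 + 2 * (cmod (g i))\<^sup>2"
    using sum_squares_bound[of "cmod (f i)" "cmod (g i)"]
    by (simp add: power2_sum)
  finally show "(cmod (f i + g i))\<^sup>2 \<le> 2 * (cmod (f i))\<^sup>2 + 2 * (cmod (g i))\<^sup>2" .
qed

lemma sq_summable_bounded_mult:
  assumes "sq_summable f" and "\<And>i. cmod (c i) \<le> B"
  shows "sq_summable (\<lambda>i. c i * f i)"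
proof (rule sq_summable_dominated[OF assms(1) sq_summable_0, where c = "B\<^sup>2"])
  fix i
  have "cmod (c i)^2 \<le> B^2"
    using assms(2) by (simp add: power_mono)
  then show "(cmod (c i * f i))\<^sup>2 \<le> B\<^sup>2 * (cmod (f i))\<^sup>2 + B\<^sup>2 * (cmod 0)\<^sup>2"
    by (simp add: norm_mult power_mult_distrib mult_right_mono)
qed

lemma sq_summable_cmult: "sq_summable f \<Longrightarrow> sq_summable (\<lambda>i. c * f i)"
  by (rule sq_summable_bounded_mult[where B = "cmod c"]) auto

lemma sq_summable_reindex:
  assumes "sq_summable f" "bij g"
  shows "sq_summable (\<lambda>i. f (g i))"
  using assms summable_on_reindex_bij_betw[of g UNIV UNIV "\<lambda>i. (cmod (f i))\<^sup>2"]
  by (simp add: sq_summable_def)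

lemma sq_summable_inner:
  assumes "sq_summable f" "sq_summable g"
  shows "(\<lambda>i. f i \<bullet> g i) summable_on UNIV"
proof (rule Infinite_Sum.abs_summable_summable, rule Infinite_Sum.abs_summable_on_comparison_test')
  show "(\<lambda>i. (cmod (f i))\<^sup>2 + (cmod (g i))\<^sup>2) summable_on UNIV"
    using assms unfolding sq_summable_def by (rule summable_on_add)
  fix i
  have "norm (f i \<bullet> g i) \<le> cmod (f i) * cmod (g i)"
    by (simp add: Cauchy_Schwarz_ineq2)
  also have "\<dots> \<le> (cmod (f i))\<^sup>2 + (cmod (g i))\<^sup>2"
    using sum_squares_bound[of "cmod (f i)" "cmod (g i)"]
      mult_nonneg_nonneg[OF norm_ge_zero[of "f i"] norm_ge_zero[of "g i"]]
    by linarith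
  finally show "norm (f i \<bullet> g i) \<le> (cmod (f i))\<^sup>2 + (cmod (g i))\<^sup>2" .
qed

typedef 'a ell2 = "{f :: 'a \<Rightarrow> complex. sq_summable f}"
  using sq_summable_0 by blast

setup_lifting type_definition_ell2

text \<open>The real inner product below is the real part of the usual complex one; it induces the
  usual norm \<open>sqrt (\<Sum>i. (cmod (f i))\<^sup>2)\<close>.\<close>

instantiation ell2 :: (type) real_inner
begin

lift_definition zero_ell2 :: "'a ell2" is "\<lambda>_. 0" by (rule sq_summable_0)

lift_definition plus_ell2 :: "'a ell2 \<Rightarrow> 'a ell2 \<Rightarrow> 'a ell2" is "\<lambda>f g i. f i + g i"
  by (rule sq_summable_add)

lift_definition uminus_ell2 :: "'a ell2 \<Rightarrow> 'a ell2" is "\<lambda>f i. - f i"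
  by (simp add: sq_summable_def)

lift_definition minus_ell2 :: "'a ell2 \<Rightarrow> 'a ell2 \<Rightarrow> 'a ell2" is "\<lambda>f g i. f i - g i"
proof -
  fix f g :: "'a \<Rightarrow> complex"
  assume "sq_summable f" "sq_summable g"
  then show "sq_summable (\<lambda>i. f i - g i)"
    using sq_summable_add[of f "\<lambda>i. - g i"] by (simp add: sq_summable_def)
qed

lift_definition scaleR_ell2 :: "real \<Rightarrow> 'a ell2 \<Rightarrow> 'a ell2" is "\<lambda>r f i. complex_of_real r * f i"
  by (rule sq_summable_cmult)

lift_definition inner_ell2 :: "'a ell2 \<Rightarrow> 'a ell2 \<Rightarrow> real" is
  "\<lambda>f g. \<Sum>\<^sub>\<infinity>i. Re (cnj (f i) * g i)" .

definition norm_ell2 :: "'a ell2 \<Rightarrow> real" where "norm_ell2 x = sqrt (x \<bullet> x)"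

definition sgn_ell2 :: "'a ell2 \<Rightarrow> 'a ell2" where "sgn_ell2 x = inverse (norm x) *\<^sub>R x"

definition dist_ell2 :: "'a ell2 \<Rightarrow> 'a ell2 \<Rightarrow> real" where "dist_ell2 x y = norm (x - y)"

definition uniformity_ell2 :: "('a ell2 \<times> 'a ell2) filter" where
  "uniformity_ell2 = (INF e\<in>{0<..}. principal {(x, y). dist x y < e})"

definition open_ell2 :: "'a ell2 set \<Rightarrow> bool" where
  "open_ell2 U \<longleftrightarrow> (\<forall>x\<in>U. \<forall>\<^sub>F (x', y) in uniformity. x' = x \<longrightarrow> y \<in> U)"

instance
proof
  have re: "Re (cnj a * b) = a \<bullet> b" for a b :: complex
    by (simp add: inner_complex_def)
  fix x y z :: "'a ell2" and r s :: real
  show "x + y + z = x + (y + z)" by transfer (simp add: add.assoc)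
  show "x + y = y + x" by transfer (simp add: add.commute)
  show "0 + x = x" by transfer simp
  show "- x + x = 0" by transfer simp
  show "x - y = x + - y" by transfer simp
  show "r *\<^sub>R (x + y) = r *\<^sub>R x + r *\<^sub>R y" by transfer (simp add: algebra_simps)
  show "(r + s) *\<^sub>R x = r *\<^sub>R x + s *\<^sub>R x" by transfer (simp add: algebra_simps)
  show "r *\<^sub>R s *\<^sub>R x = (r * s) *\<^sub>R x" by transfer (simp add: algebra_simps)
  show "1 *\<^sub>R x = x" by transfer simp
  show "x \<bullet> y = y \<bullet> x" by transfer (simp add: mult.commute)
  show "(x + y) \<bullet> z = x \<bullet> z + y \<bullet> z"
    by transfer (unfold re inner_add_left, rule infsum_add; rule sq_summable_inner; assumption)
  show "(r *\<^sub>R x) \<bullet> y = r * (x \<bullet> y)"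
  proof transfer
    fix r and f g :: "'a \<Rightarrow> complex"
    have "Re (cnj (complex_of_real r * f i) * g i) = r * Re (cnj (f i) * g i)" for i
      by (simp add: algebra_simps)
    then show "(\<Sum>\<^sub>\<infinity>i. Re (cnj (complex_of_real r * f i) * g i)) = r * (\<Sum>\<^sub>\<infinity>i. Re (cnj (f i) * g i))"
      by (subst infsum_cmult_right'[symmetric]) (rule infsum_cong)
  qed
  show "0 \<le> x \<bullet> x"
    by transfer (unfold re, rule infsum_nonneg, simp)
  show "x \<bullet> x = 0 \<longleftrightarrow> x = 0"
  proof transfer
    fix f :: "'a \<Rightarrow> complex"
    assume f: "sq_summable f"
    have "f i = 0" if "(\<Sum>\<^sub>\<infinity>i. f i \<bullet> f i) = 0" for i
    proof -
      have "f i \<bullet> f i = 0"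
        by (rule nonneg_infsum_le_0D[where A = UNIV])
          (simp_all only: that order_refl inner_ge_zero sq_summable_inner[OF f f] UNIV_I)
      then show ?thesis by simp
    qed
    then have "(\<Sum>\<^sub>\<infinity>i. f i \<bullet> f i) = 0 \<Longrightarrow> f = (\<lambda>_. 0)"
      by blast
    moreover have "f = (\<lambda>_. 0) \<Longrightarrow> (\<Sum>\<^sub>\<infinity>i. f i \<bullet> f i) = 0"
      by simp
    ultimately show "(\<Sum>\<^sub>\<infinity>i. Re (cnj (f i) * f i)) = 0 \<longleftrightarrow> f = (\<lambda>_. 0)"
      unfolding re by blast
  qed
  show "norm x = sqrt (x \<bullet> x)" by (rule norm_ell2_def)
  show "sgn x = inverse (norm x) *\<^sub>R x" by (rule sgn_ell2_def)
  show "dist x y = norm (x - y)" by (rule dist_ell2_def)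
  show "uniformity = (INF e\<in>{0<..}. principal {(x :: 'a ell2, y). dist x y < e})"
    by (rule uniformity_ell2_def)
  fix U :: "'a ell2 set"
  show "open U \<longleftrightarrow> (\<forall>x\<in>U. \<forall>\<^sub>F (x', y) in uniformity. x' = x \<longrightarrow> y \<in> U)"
    by (rule open_ell2_def)
qed

end

lemma norm_ell2_sq: "(norm x)\<^sup>2 = (\<Sum>\<^sub>\<infinity>i. (cmod (Rep_ell2 x i))\<^sup>2)"
proof -
  have "(norm x)\<^sup>2 = x \<bullet> x"
    by (simp add: power2_norm_eq_inner)
  also have "\<dots> = (\<Sum>\<^sub>\<infinity>i. (cmod (Rep_ell2 x i))\<^sup>2)"
    unfolding inner_ell2.rep_eq by (rule infsum_cong) (unfold cmod_power2, simp add: power2_eq_square)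
  finally show ?thesis .
qed

lemma sq_summable_Rep_ell2: "sq_summable (Rep_ell2 x)"
  using Rep_ell2[of x] by simp

lemma sum_le_norm_ell2_sq:
  "finite F \<Longrightarrow> (\<Sum>i\<in>F. (cmod (Rep_ell2 x i))\<^sup>2) \<le> (norm x)\<^sup>2"
  unfolding norm_ell2_sq
  using sq_summable_Rep_ell2[of x, unfolded sq_summable_def]
  by (rule finite_sum_le_infsum) simp_all

lemma cmod_le_norm_ell2: "cmod (Rep_ell2 x i) \<le> norm x"
  using sum_le_norm_ell2_sq[of "{i}" x] by (simp add: power2_le_iff_abs_le)

lemma sq_summableI_bound:
  assumes "\<And>F. finite F \<Longrightarrow> (\<Sum>i\<in>F. (cmod (f i))\<^sup>2) \<le> B"
  shows "sq_summable f"
  unfolding sq_summable_def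
  by (rule nonneg_bdd_above_summable_on, simp, rule bdd_aboveI[where M = B]) (use assms in auto)

lemma norm_ell2_leI:
  assumes "0 \<le> e" "\<And>F. finite F \<Longrightarrow> (\<Sum>i\<in>F. (cmod (Rep_ell2 x i))\<^sup>2) \<le> e\<^sup>2"
  shows "norm x \<le> e"
proof -
  have "(norm x)\<^sup>2 \<le> e\<^sup>2"
    unfolding norm_ell2_sq using sq_summable_Rep_ell2[of x, unfolded sq_summable_def] assms(2)
    by (rule infsum_le_finite_sums)
  then show ?thesis
    using assms(1) by (rule power2_le_imp_le)
qed

instance ell2 :: (type) banach
proof
  fix X :: "nat \<Rightarrow> 'a ell2"
  assume X: "Cauchy X"
  have "Cauchy (\<lambda>n. Rep_ell2 (X n) i)" for i
  proof (rule CauchyI)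
    fix e :: real assume "0 < e"
    then obtain k where k: "\<And>m n. k \<le> m \<Longrightarrow> k \<le> n \<Longrightarrow> norm (X m - X n) < e"
      using CauchyD[OF X] by blast
    have "cmod (Rep_ell2 (X m) i - Rep_ell2 (X n) i) < e" if "k \<le> m" "k \<le> n" for m n
      using cmod_le_norm_ell2[of "X m - X n" i] k[OF that] by (simp add: minus_ell2.rep_eq)
    then show "\<exists>k. \<forall>m\<ge>k. \<forall>n\<ge>k. cmod (Rep_ell2 (X m) i - Rep_ell2 (X n) i) < e"
      by blast
  qed
  then have "\<forall>i. \<exists>l. (\<lambda>n. Rep_ell2 (X n) i) \<longlonglongrightarrow> l"
    using Cauchy_convergent convergent_def by blast
  then obtain g where g: "\<And>i. (\<lambda>n. Rep_ell2 (X n) i) \<longlonglongrightarrow> g i"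
    by metis
  have tail: "(\<Sum>i\<in>F. (cmod (g i - Rep_ell2 (X n) i))\<^sup>2) \<le> e\<^sup>2"
    if "finite F" and n: "k \<le> n"
      and k: "\<And>m n. k \<le> m \<Longrightarrow> k \<le> n \<Longrightarrow> norm (X m - X n) < e" for F k n e
  proof (rule tendsto_upperbound)
    show "(\<lambda>m. \<Sum>i\<in>F. (cmod (Rep_ell2 (X m) i - Rep_ell2 (X n) i))\<^sup>2)
        \<longlonglongrightarrow> (\<Sum>i\<in>F. (cmod (g i - Rep_ell2 (X n) i))\<^sup>2)"
      by (intro tendsto_intros g)
    have "(\<Sum>i\<in>F. (cmod (Rep_ell2 (X m) i - Rep_ell2 (X n) i))\<^sup>2) \<le> e\<^sup>2" if "k \<le> m" for m
    proof -
      have "(norm (X m - X n))\<^sup>2 \<le> e\<^sup>2"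
        using k[OF that n] by (intro power_mono) auto
      then show ?thesis
        using sum_le_norm_ell2_sq[OF \<open>finite F\<close>, of "X m - X n"] by (simp add: minus_ell2.rep_eq)
    qed
    then show "\<forall>\<^sub>F m in sequentially.
        (\<Sum>i\<in>F. (cmod (Rep_ell2 (X m) i - Rep_ell2 (X n) i))\<^sup>2) \<le> e\<^sup>2"
      by (auto simp: eventually_sequentially)
  qed simp
  have "sq_summable g"
  proof -
    obtain k where k: "\<And>m n. k \<le> m \<Longrightarrow> k \<le> n \<Longrightarrow> norm (X m - X n) < 1"
      using CauchyD[OF X, of 1] by auto
    have "sq_summable (\<lambda>i. g i - Rep_ell2 (X k) i)"
      by (rule sq_summableI_bound) (rule tail[OF _ order_refl k])
    from sq_summable_add[OF this sq_summable_Rep_ell2[of "X k"]] show ?thesis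
      by simp
  qed
  then have G: "Rep_ell2 (Abs_ell2 g) = g"
    by (simp add: Abs_ell2_inverse)
  have "X \<longlonglongrightarrow> Abs_ell2 g"
  proof (rule LIMSEQ_I)
    fix e :: real assume "0 < e"
    then obtain k where k: "\<And>m n. k \<le> m \<Longrightarrow> k \<le> n \<Longrightarrow> norm (X m - X n) < e / 2"
      using CauchyD[OF X, of "e / 2"] by auto
    have "norm (Abs_ell2 g - X n) \<le> e / 2" if "k \<le> n" for n
      using \<open>0 < e\<close> tail[OF _ that k]
      by (intro norm_ell2_leI) (auto simp: minus_ell2.rep_eq G)
    then have "norm (X n - Abs_ell2 g) < e" if "k \<le> n" for n
      using that \<open>0 < e\<close> by (smt (verit, best) field_sum_of_halves norm_minus_commute)
    then show "\<exists>k. \<forall>n\<ge>k. norm (X n - Abs_ell2 g) < e"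
      by blast
  qed
  then show "convergent X"
    by (auto simp: convergent_def)
qed


subsection \<open>Bounded operators and the spectrum\<close>

lift_definition scale_ell2 :: "complex \<Rightarrow> 'a ell2 \<Rightarrow> 'a ell2" is "\<lambda>c f i. c * f i"
  by (rule sq_summable_cmult)

definition bounded_clinear :: "('a ell2 \<Rightarrow> 'b ell2) \<Rightarrow> bool" where
  "bounded_clinear T \<longleftrightarrow>
     bounded_linear T \<and> (\<forall>c x. T (scale_ell2 c x) = scale_ell2 c (T x))"

definition resolvent_set :: "('a ell2 \<Rightarrow> 'a ell2) \<Rightarrow> complex set" where
  "resolvent_set T =
     {z. \<exists>R. bounded_clinear R \<and> (\<forall>x. R (T x - scale_ell2 z x) = x)
                              \<and> (\<forall>y. T (R y) - scale_ell2 z (R y) = y)}"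

definition spectrum :: "('a ell2 \<Rightarrow> 'a ell2) \<Rightarrow> complex set" where
  "spectrum T = - resolvent_set T"

lemma norm_scale_ell2: "norm (scale_ell2 c x) = cmod c * norm x"
proof -
  have "(norm (scale_ell2 c x))\<^sup>2 = (cmod c * norm x)\<^sup>2"
    unfolding power_mult_distrib norm_ell2_sq scale_ell2.rep_eq norm_mult
    by (rule infsum_cmult_right')
  then show ?thesis
    by simp
qed

lemma scale_ell2_simps:
  "scale_ell2 c (x + y) = scale_ell2 c x + scale_ell2 c y"
  "scale_ell2 c (x - y) = scale_ell2 c x - scale_ell2 c y"
  "scale_ell2 (c + d) x = scale_ell2 c x + scale_ell2 d x"
  "scale_ell2 (c - d) x = scale_ell2 c x - scale_ell2 d x"
  "scale_ell2 c (scale_ell2 d x) = scale_ell2 (c * d) x"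
  "scale_ell2 c (r *\<^sub>R x) = r *\<^sub>R scale_ell2 c x"
  "scale_ell2 (complex_of_real r) x = r *\<^sub>R x"
  "scale_ell2 1 x = x"
  by (transfer; simp add: algebra_simps)+

text \<open>Invertibility of \<open>T - w\<close> follows from invertibility of \<open>T - z\<close> by solving
  \<open>x = (T - z)\<^sup>-\<^sup>1 (y + (w - z) x)\<close> with Banach's fixed point theorem.\<close>

lemma resolvent_set_perturb:
  fixes T :: "'a ell2 \<Rightarrow> 'a ell2"
  assumes T: "bounded_clinear T" and R: "bounded_clinear R"
    and RT: "\<And>x. R (T x - scale_ell2 z x) = x"
    and TR: "\<And>y. T (R y) - scale_ell2 z (R y) = y"
    and K: "0 \<le> K" "\<And>y. norm (R y) \<le> K * norm y"
    and w: "cmod (w - z) * K < 1"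
  shows "w \<in> resolvent_set T"
proof -
  interpret T: bounded_linear T using T by (simp add: bounded_clinear_def)
  interpret R: bounded_linear R using R by (simp add: bounded_clinear_def)
  have Tc: "T (scale_ell2 c x) = scale_ell2 c (T x)" for c x
    using T by (simp add: bounded_clinear_def)
  define d where "d = w - z"
  define k where "k = cmod d * K"
  have k: "0 \<le> k" "k < 1"
    using w K(1) by (simp_all add: k_def d_def)
  have Rd: "norm (R (scale_ell2 d x)) \<le> k * norm x" for x
    using K(2)[of "scale_ell2 d x"] by (simp add: norm_scale_ell2 k_def mult_ac)
  have eq: "T x - scale_ell2 w x = y \<longleftrightarrow> R (y + scale_ell2 d x) = x" for x y
  proof
    assume "T x - scale_ell2 w x = y"
    then have "y + scale_ell2 d x = T x - scale_ell2 z x"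
      by (auto simp: d_def scale_ell2_simps)
    then show "R (y + scale_ell2 d x) = x"
      by (simp add: RT)
  next
    assume "R (y + scale_ell2 d x) = x"
    then have "T x - scale_ell2 z x = y + scale_ell2 d x"
      using TR[of "y + scale_ell2 d x"] by simp
    then show "T x - scale_ell2 w x = y"
      by (simp add: d_def scale_ell2_simps algebra_simps)
  qed
  have "\<exists>!x. R (y + scale_ell2 d x) = x" for y
  proof (rule banach_fix_type[OF k], intro allI)
    fix x x'
    have "R (y + scale_ell2 d x) - R (y + scale_ell2 d x') = R (scale_ell2 d (x - x'))"
      by (simp add: R.diff[symmetric] scale_ell2_simps)
    then show "dist (R (y + scale_ell2 d x)) (R (y + scale_ell2 d x')) \<le> k * dist x x'"
      using Rd[of "x - x'"] by (simp add: dist_norm)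
  qed
  then have ex1: "\<exists>!x. T x - scale_ell2 w x = y" for y
    by (simp add: eq)
  define S where "S y = (THE x. T x - scale_ell2 w x = y)" for y
  have S: "T (S y) - scale_ell2 w (S y) = y" for y
    unfolding S_def using theI'[OF ex1] .
  have Su: "S y = x" if "T x - scale_ell2 w x = y" for x y
    using ex1 S that by blast
  have "norm (S y) \<le> norm y * (K / (1 - k))" for y
  proof -
    have "S y = R y + R (scale_ell2 d (S y))"
      using S[of y] unfolding eq by (simp add: R.add)
    then have "norm (S y) \<le> norm (R y) + norm (R (scale_ell2 d (S y)))"
      by (metis norm_triangle_ineq)
    then have "norm (S y) \<le> K * norm y + k * norm (S y)"
      using K(2)[of y] Rd[of "S y"] by linarith
    then show ?thesis
      using k by (simp add: field_simps)
  qed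
  moreover have "S (x + y) = S x + S y" for x y
    by (rule Su) (metis S T.add add_diff_add scale_ell2_simps(1))
  moreover have "S (r *\<^sub>R x) = r *\<^sub>R S x" for r x
    by (rule Su) (metis S T.scaleR scaleR_diff_right scale_ell2_simps(6))
  ultimately have "bounded_linear S"
    by (intro bounded_linear_intro)
  moreover have "S (scale_ell2 c x) = scale_ell2 c (S x)" for c x
    by (rule Su) (metis S Tc scale_ell2_simps(2,5) mult.commute)
  ultimately have "bounded_clinear S"
    by (simp add: bounded_clinear_def)
  moreover have "S (T x - scale_ell2 w x) = x" for x
    by (rule Su) simp
  ultimately show ?thesis
    unfolding resolvent_set_def using S by blast
qed

lemma closed_spectrum:
  assumes T: "bounded_clinear T"
  shows "closed (spectrum T)"
proof -
  have "\<exists>e>0. ball z e \<subseteq> resolvent_set T" if z: "z \<in> resolvent_set T" for z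
  proof -
    obtain R where R: "bounded_clinear R" "\<And>x. R (T x - scale_ell2 z x) = x"
      "\<And>y. T (R y) - scale_ell2 z (R y) = y"
      using z by (auto simp: resolvent_set_def)
    obtain K where K: "0 < K" "\<And>y. norm (R y) \<le> norm y * K"
      using bounded_linear.pos_bounded R(1) unfolding bounded_clinear_def by blast
    have "w \<in> resolvent_set T" if "w \<in> ball z (1 / K)" for w
      by (rule resolvent_set_perturb[OF T R, where K = K])
        (use that K in \<open>auto simp: dist_norm field_simps norm_minus_commute\<close>)
    then show ?thesis
      using K(1) by (intro exI[of _ "1 / K"]) auto
  qed
  then have "open (resolvent_set T)"
    by (simp add: open_contains_ball)
  then show ?thesis
    by (simp add: spectrum_def closed_def)
qed

lemma large_in_resolvent_set:
  assumes T: "bounded_clinear T" and K: "\<And>x. norm (T x) \<le> norm x * K" "0 \<le> K" "K < cmod z"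
  shows "z \<in> resolvent_set T"
proof -
  interpret T: bounded_linear T using T by (simp add: bounded_clinear_def)
  have Tc: "T (scale_ell2 c x) = scale_ell2 c (T x)" for c x
    using T by (simp add: bounded_clinear_def)
  have z: "0 < cmod z" "z \<noteq> 0" using K by auto
  define k where "k = K / cmod z"
  have k: "0 \<le> k" "k < 1" using K z by (simp_all add: k_def)
  have Tz: "norm (scale_ell2 (1 / z) (T x)) \<le> k * norm x" for x
    using K(1)[of x] z by (simp add: norm_scale_ell2 norm_divide k_def field_simps)
  have eq: "T x - scale_ell2 z x = y \<longleftrightarrow> scale_ell2 (1 / z) (T x - y) = x" for x y
  proof
    assume "T x - scale_ell2 z x = y"
    then have "T x - y = scale_ell2 z x" by auto
    then show "scale_ell2 (1 / z) (T x - y) = x"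
      using z by (simp add: scale_ell2_simps)
  next
    assume a: "scale_ell2 (1 / z) (T x - y) = x"
    have "scale_ell2 z x = T x - y"
      unfolding a[symmetric, THEN arg_cong[where f = "scale_ell2 z"]]
      using z by (simp add: scale_ell2_simps(5,8))
    then show "T x - scale_ell2 z x = y" by simp
  qed
  have "\<exists>!x. scale_ell2 (1 / z) (T x - y) = x" for y
  proof (rule banach_fix_type[OF k], intro allI)
    fix x x'
    have "scale_ell2 (1 / z) (T x - y) - scale_ell2 (1 / z) (T x' - y)
        = scale_ell2 (1 / z) (T (x - x'))"
      by (simp add: scale_ell2_simps(2)[symmetric] T.diff)
    then show "dist (scale_ell2 (1 / z) (T x - y)) (scale_ell2 (1 / z) (T x' - y)) \<le> k * dist x x'"
      using Tz[of "x - x'"] by (simp add: dist_norm)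
  qed
  then have ex1: "\<exists>!x. T x - scale_ell2 z x = y" for y
    by (simp add: eq)
  define S where "S y = (THE x. T x - scale_ell2 z x = y)" for y
  have S: "T (S y) - scale_ell2 z (S y) = y" for y
    unfolding S_def using theI'[OF ex1] .
  have Su: "S y = x" if "T x - scale_ell2 z x = y" for x y
    using ex1 S that by blast
  have "norm (S y) \<le> norm y * (1 / (cmod z - K))" for y
  proof -
    have "scale_ell2 z (S y) = T (S y) - y"
      using S[of y] by (simp add: algebra_simps)
    then have "cmod z * norm (S y) \<le> norm (T (S y)) + norm y"
      by (metis norm_scale_ell2 norm_triangle_ineq4)
    then have "cmod z * norm (S y) \<le> norm (S y) * K + norm y"
      using K(1)[of "S y"] by linarith
    then show ?thesis
      using K by (simp add: field_simps)
  qed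
  moreover have "S (x + y) = S x + S y" for x y
    by (rule Su) (metis S T.add add_diff_add scale_ell2_simps(1))
  moreover have "S (r *\<^sub>R x) = r *\<^sub>R S x" for r x
    by (rule Su) (metis S T.scaleR scaleR_diff_right scale_ell2_simps(6))
  ultimately have "bounded_linear S"
    by (intro bounded_linear_intro)
  moreover have "S (scale_ell2 c x) = scale_ell2 c (S x)" for c x
    by (rule Su) (metis S Tc scale_ell2_simps(2,5) mult.commute)
  ultimately have "bounded_clinear S"
    by (simp add: bounded_clinear_def)
  moreover have "S (T x - scale_ell2 z x) = x" for x
    by (rule Su) simp
  ultimately show ?thesis
    unfolding resolvent_set_def using S by blast
qed

lemma inner_scale_ii: "scale_ell2 \<i> x \<bullet> y = - (x \<bullet> scale_ell2 \<i> y)"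
proof -
  have "scale_ell2 \<i> x \<bullet> y = (\<Sum>\<^sub>\<infinity>i. - Re (cnj (Rep_ell2 x i) * (\<i> * Rep_ell2 y i)))"
    unfolding inner_ell2.rep_eq scale_ell2.rep_eq by (rule infsum_cong) simp
  then show ?thesis
    by (simp only: infsum_uminus inner_ell2.rep_eq scale_ell2.rep_eq)
qed

lemma spectrum_symmetric_real:
  assumes T: "bounded_clinear T" and sym: "\<And>x y. T x \<bullet> y = x \<bullet> T y"
  shows "spectrum T \<subseteq> \<real>"
proof -
  interpret T: bounded_linear T using T by (simp add: bounded_clinear_def)
  have Tc: "T (scale_ell2 c x) = scale_ell2 c (T x)" for c x
    using T by (simp add: bounded_clinear_def)
  have bound: "\<bar>b\<bar> * norm x \<le> norm (T x - scale_ell2 (\<i> * complex_of_real b) x)" for b x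
  proof -
    let ?u = "scale_ell2 \<i> x"
    have "T x \<bullet> ?u = - (T x \<bullet> ?u)"
      by (metis Tc inner_commute inner_scale_ii sym)
    then have 0: "T x \<bullet> ?u = 0" by simp
    have "scale_ell2 (\<i> * complex_of_real b) x = b *\<^sub>R ?u"
      by (metis mult.commute scale_ell2_simps(5,7))
    then have "(norm (T x - scale_ell2 (\<i> * complex_of_real b) x))\<^sup>2
        = (norm (T x))\<^sup>2 + (norm (b *\<^sub>R ?u))\<^sup>2"
      using 0 by (simp add: power2_norm_eq_inner inner_diff_left inner_diff_right inner_commute
          del: norm_scaleR)
    also have "norm (b *\<^sub>R ?u) = \<bar>b\<bar> * norm x"
      by (simp add: norm_scale_ell2)
    finally have "(norm (T x - scale_ell2 (\<i> * complex_of_real b) x))\<^sup>2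
        = (norm (T x))\<^sup>2 + (\<bar>b\<bar> * norm x)\<^sup>2" .
    then have "(\<bar>b\<bar> * norm x)\<^sup>2 \<le> (norm (T x - scale_ell2 (\<i> * complex_of_real b) x))\<^sup>2"
      by simp
    then show ?thesis
      by (rule power2_le_imp_le) simp
  qed
  obtain K where K: "0 < K" "\<And>x. norm (T x) \<le> norm x * K"
    using T.pos_bounded by blast
  have "w \<in> resolvent_set T" if w: "Im w \<noteq> 0" for w
  proof -
    define L where "L = K + 1 + (cmod w)\<^sup>2 / \<bar>Im w\<bar>"
    have L: "K < L" "0 < L" "(cmod w)\<^sup>2 < 2 * L * \<bar>Im w\<bar>"
    proof -
      have "0 \<le> (cmod w)\<^sup>2 / \<bar>Im w\<bar>" by simp
      then show "K < L" "0 < L" using K(1) unfolding L_def by linarith+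
      have "L * \<bar>Im w\<bar> = (K + 1) * \<bar>Im w\<bar> + (cmod w)\<^sup>2"
        using w by (simp add: L_def field_simps)
      moreover have "0 < (K + 1) * \<bar>Im w\<bar>" using K(1) w by simp
      ultimately show "(cmod w)\<^sup>2 < 2 * L * \<bar>Im w\<bar>"
        using zero_le_power2[of "cmod w"] by linarith
    qed
    define b where "b = sgn (Im w) * L"
    have b: "\<bar>b\<bar> = L" "b\<^sup>2 = L\<^sup>2" "b * Im w = L * \<bar>Im w\<bar>"
      using w L by (auto simp: b_def abs_mult sgn_if)
    define z where "z = \<i> * complex_of_real b"
    have "z \<in> resolvent_set T"
      by (rule large_in_resolvent_set[OF T K(2)]) (use K L b in \<open>auto simp: z_def norm_mult\<close>)
    then obtain R where R: "bounded_clinear R" "\<And>x. R (T x - scale_ell2 z x) = x"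
      "\<And>y. T (R y) - scale_ell2 z (R y) = y"
      by (auto simp: resolvent_set_def)
    have "norm (R y) \<le> (1 / L) * norm y" for y
      using bound[of b "R y"] R(3)[of y] b(1) L by (simp add: z_def field_simps)
    moreover have "cmod (w - z) * (1 / L) < 1"
    proof -
      have "(cmod (w - z))\<^sup>2 = (cmod w)\<^sup>2 - 2 * (b * Im w) + b\<^sup>2"
        unfolding cmod_power2 z_def by (simp add: power2_diff algebra_simps)
      also have "\<dots> < L\<^sup>2"
        using L(3) unfolding b(2,3) by linarith
      finally have "cmod (w - z) < L"
        by (rule power_less_imp_less_base) (use L(2) in simp)
      then show ?thesis using L(2) by simp
    qed
    ultimately show ?thesis
      using resolvent_set_perturb[OF T R, of "1 / L" w] L(2) by simp
  qed
  then show ?thesis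
    unfolding spectrum_def complex_is_Real_iff subset_iff Compl_iff by blast
qed


subsection \<open>The discrete Schroedinger operator on the square lattice\<close>

text \<open>\<^const>\<open>Abs_ell2\<close> is only meaningful on square-summable arguments, so this is the intended
  operator for bounded potentials only; see the equation \<open>schroedinger_apply\<close> below.\<close>

definition schroedinger :: "(int \<Rightarrow> int \<Rightarrow> real) \<Rightarrow> (int \<times> int) ell2 \<Rightarrow> (int \<times> int) ell2" where
  "schroedinger q y = Abs_ell2 (\<lambda>(n, m).
     Rep_ell2 y (n, m - 1) + Rep_ell2 y (n, m + 1)
   + Rep_ell2 y (n - 1, m) + Rep_ell2 y (n + 1, m)
   + complex_of_real (q n m) * Rep_ell2 y (n, m))"

lift_definition shift_ell2 :: "int \<Rightarrow> int \<Rightarrow> (int \<times> int) ell2 \<Rightarrow> (int \<times> int) ell2" is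
  "\<lambda>a b f i. f (fst i + a, snd i + b)"
proof -
  fix a b :: int and f :: "int \<times> int \<Rightarrow> complex"
  have "bij (\<lambda>i::int \<times> int. (fst i + a, snd i + b))"
    by (rule bij_betw_byWitness[where f' = "\<lambda>i. (fst i - a, snd i - b)"]) auto
  then show "sq_summable f \<Longrightarrow> sq_summable (\<lambda>i. f (fst i + a, snd i + b))"
    by (rule sq_summable_reindex[rotated])
qed

definition potential_ell2 :: "(int \<Rightarrow> int \<Rightarrow> real) \<Rightarrow> (int \<times> int) ell2 \<Rightarrow> (int \<times> int) ell2" where
  "potential_ell2 q y = Abs_ell2 (\<lambda>i. complex_of_real (q (fst i) (snd i)) * Rep_ell2 y i)"

lemma Rep_potential_ell2:
  assumes "\<And>n m. \<bar>q n m\<bar> \<le> B"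
  shows "Rep_ell2 (potential_ell2 q y) =
    (\<lambda>i. complex_of_real (q (fst i) (snd i)) * Rep_ell2 y i)"
proof -
  have "sq_summable (\<lambda>i. complex_of_real (q (fst i) (snd i)) * Rep_ell2 y i)"
    by (rule sq_summable_bounded_mult[OF sq_summable_Rep_ell2, where B = B]) (simp add: assms)
  then show ?thesis
    by (simp add: potential_ell2_def Abs_ell2_inverse)
qed

lemma schroedinger_decomp:
  assumes "\<And>n m. \<bar>q n m\<bar> \<le> B"
  shows "schroedinger q y = shift_ell2 0 (- 1) y + shift_ell2 0 1 y + shift_ell2 (- 1) 0 y
    + shift_ell2 1 0 y + potential_ell2 q y"
proof -
  let ?r = "shift_ell2 0 (- 1) y + shift_ell2 0 1 y + shift_ell2 (- 1) 0 y
    + shift_ell2 1 0 y + potential_ell2 q y"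
  have "(\<lambda>(n, m). Rep_ell2 y (n, m - 1) + Rep_ell2 y (n, m + 1)
      + Rep_ell2 y (n - 1, m) + Rep_ell2 y (n + 1, m)
      + complex_of_real (q n m) * Rep_ell2 y (n, m)) = Rep_ell2 ?r"
    by (auto simp: fun_eq_iff plus_ell2.rep_eq shift_ell2.rep_eq Rep_potential_ell2[OF assms])
  then show ?thesis
    by (simp add: schroedinger_def Rep_ell2_inverse)
qed

lemma schroedinger_apply:
  assumes "\<And>n m. \<bar>q n m\<bar> \<le> B"
  shows "Rep_ell2 (schroedinger q y) (n, m) =
     Rep_ell2 y (n, m - 1) + Rep_ell2 y (n, m + 1)
   + Rep_ell2 y (n - 1, m) + Rep_ell2 y (n + 1, m)
   + complex_of_real (q n m) * Rep_ell2 y (n, m)"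
  by (simp add: schroedinger_decomp[OF assms] plus_ell2.rep_eq shift_ell2.rep_eq
      Rep_potential_ell2[OF assms])

lemma ell2_pair_eqI: "(\<And>n m. Rep_ell2 x (n, m) = Rep_ell2 y (n, m)) \<Longrightarrow> x = y"
  by (metis Rep_ell2_inject ext surj_pair)

lemma norm_shift_ell2: "norm (shift_ell2 a b y) = norm y"
proof -
  have "bij (\<lambda>i::int \<times> int. (fst i + a, snd i + b))"
    by (rule bij_betw_byWitness[where f' = "\<lambda>i. (fst i - a, snd i - b)"]) auto
  from infsum_reindex_bij_betw[OF this, of "\<lambda>i. (cmod (Rep_ell2 y i))\<^sup>2"]
  have "(norm (shift_ell2 a b y))\<^sup>2 = (norm y)\<^sup>2"
    by (simp add: norm_ell2_sq shift_ell2.rep_eq)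
  then show ?thesis
    by simp
qed

lemma norm_potential_ell2:
  assumes "\<And>n m. \<bar>q n m\<bar> \<le> B"
  shows "norm (potential_ell2 q y) \<le> B * norm y"
proof (rule norm_ell2_leI)
  have B: "0 \<le> B"
    using assms[of 0 0] by simp
  then show "0 \<le> B * norm y" by simp
  fix F :: "(int \<times> int) set" assume "finite F"
  have "(\<Sum>i\<in>F. (cmod (Rep_ell2 (potential_ell2 q y) i))\<^sup>2)
      \<le> (\<Sum>i\<in>F. B\<^sup>2 * (cmod (Rep_ell2 y i))\<^sup>2)"
  proof (rule sum_mono)
    fix i
    have "\<bar>q (fst i) (snd i)\<bar>\<^sup>2 \<le> B\<^sup>2"
      using assms by (intro power_mono) auto
    then show "(cmod (Rep_ell2 (potential_ell2 q y) i))\<^sup>2 \<le> B\<^sup>2 * (cmod (Rep_ell2 y i))\<^sup>2"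
      by (simp add: Rep_potential_ell2[OF assms] norm_mult power_mult_distrib mult_right_mono)
  qed
  also have "\<dots> \<le> B\<^sup>2 * (norm y)\<^sup>2"
    unfolding sum_distrib_left[symmetric]
    using sum_le_norm_ell2_sq[OF \<open>finite F\<close>, of y] by (simp add: mult_left_mono)
  finally show "(\<Sum>i\<in>F. (cmod (Rep_ell2 (potential_ell2 q y) i))\<^sup>2) \<le> (B * norm y)\<^sup>2"
    by (simp add: power_mult_distrib)
qed

lemma bounded_clinear_schroedinger:
  assumes "\<And>n m. \<bar>q n m\<bar> \<le> B"
  shows "bounded_clinear (schroedinger q)"
  unfolding bounded_clinear_def
proof (intro conjI allI)
  show "bounded_linear (schroedinger q)"
  proof (rule bounded_linear_intro)
    fix x y :: "(int \<times> int) ell2" and r :: real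
    show "schroedinger q (x + y) = schroedinger q x + schroedinger q y"
      by (rule ell2_pair_eqI)
        (simp add: schroedinger_apply[OF assms] plus_ell2.rep_eq algebra_simps)
    show "schroedinger q (r *\<^sub>R x) = r *\<^sub>R schroedinger q x"
      by (rule ell2_pair_eqI)
        (simp add: schroedinger_apply[OF assms] scaleR_ell2.rep_eq algebra_simps)
    have "norm (schroedinger q x) \<le> norm x + norm x + norm x + norm x + B * norm x"
      unfolding schroedinger_decomp[OF assms]
      by (intro norm_triangle_le add_mono norm_potential_ell2 assms)
        (auto simp: norm_shift_ell2)
    then show "norm (schroedinger q x) \<le> norm x * (4 + B)"
      by (simp add: algebra_simps)
  qed
  show "schroedinger q (scale_ell2 c x) = scale_ell2 c (schroedinger q x)" for c x
    by (rule ell2_pair_eqI)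
      (simp add: schroedinger_apply[OF assms] scale_ell2.rep_eq algebra_simps)
qed

lemma inner_ell2_eq: "x \<bullet> y = (\<Sum>\<^sub>\<infinity>i. Rep_ell2 x i \<bullet> Rep_ell2 y i)"
  unfolding inner_ell2.rep_eq by (rule infsum_cong) (simp add: inner_complex_def)

lemma inner_shift_ell2: "shift_ell2 a b x \<bullet> y = x \<bullet> shift_ell2 (- a) (- b) y"
proof -
  have "bij (\<lambda>i::int \<times> int. (fst i + a, snd i + b))"
    by (rule bij_betw_byWitness[where f' = "\<lambda>i. (fst i - a, snd i - b)"]) auto
  from infsum_reindex_bij_betw[OF this,
      of "\<lambda>i. Rep_ell2 x i \<bullet> Rep_ell2 (shift_ell2 (- a) (- b) y) i"]
  show ?thesis
    by (simp add: inner_ell2_eq shift_ell2.rep_eq)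
qed

lemma schroedinger_symmetric:
  assumes "\<And>n m. \<bar>q n m\<bar> \<le> B"
  shows "schroedinger q x \<bullet> y = x \<bullet> schroedinger q y"
proof -
  have "potential_ell2 q x \<bullet> y = x \<bullet> potential_ell2 q y"
    unfolding inner_ell2_eq Rep_potential_ell2[OF assms]
    by (rule infsum_cong) (simp add: inner_complex_def algebra_simps)
  then show ?thesis
    by (simp add: schroedinger_decomp[OF assms] inner_add_left inner_add_right inner_shift_ell2)
qed

lemma periodic_bounded:
  fixes q :: "int \<Rightarrow> int \<Rightarrow> real" and N M :: nat
  assumes "1 \<le> N" "1 \<le> M"
    and "\<And>n m. q (n + int N) m = q n m" "\<And>n m. q n (m + int M) = q n m"
  shows "\<exists>B. \<forall>n m. \<bar>q n m\<bar> \<le> B"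
proof -
  have per: "f (k mod p) = f k" if f: "\<And>k. f (k + p) = f k" for f :: "int \<Rightarrow> real" and k p
  proof -
    have up: "f (k + int j * p) = f k" for j k
    proof (induction j)
      case (Suc j)
      have "f (k + int (Suc j) * p) = f ((k + int j * p) + p)"
        by (rule arg_cong[where f = f]) (simp add: distrib_right)
      then show ?case
        using f Suc.IH by presburger
    qed simp
    have "f (k + j * p) = f k" for j k
      using up[of k "nat j"] up[of "k + j * p" "nat (- j)"] by (cases "0 \<le> j") auto
    from this[of "k mod p" "k div p"] show ?thesis
      by simp
  qed
  define S where "S = (\<lambda>(n, m). \<bar>q n m\<bar>) ` ({0..<int N} \<times> {0..<int M})"
  have "\<bar>q n m\<bar> \<le> Max S" for n m
  proof (rule Max_ge)
    have "q n m = q (n mod int N) (m mod int M)"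
      using per[of "\<lambda>n. q n m" "int N" n] per[of "q (n mod int N)" "int M" m] assms(3,4)
      by simp
    then show "\<bar>q n m\<bar> \<in> S"
      using assms(1,2) by (auto simp: S_def intro!: image_eqI[where x = "(n mod int N, m mod int M)"])
  qed (simp add: S_def)
  then show ?thesis by blast
qed

text \<open>For a bounded potential the spectrum is therefore a closed subset of the real line; in
  particular it is Lebesgue measurable, and intersecting it with the reals loses nothing.\<close>

lemma spectrum_schroedinger:
  assumes "\<And>n m. \<bar>q n m\<bar> \<le> B"
  shows "spectrum (schroedinger q) \<subseteq> \<real>"
    and "closed {x. complex_of_real x \<in> spectrum (schroedinger q)}"
    and "{x. complex_of_real x \<in> spectrum (schroedinger q)} \<in> sets lebesgue"
proof -
  note bcl = bounded_clinear_schroedinger[OF assms]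
  show "spectrum (schroedinger q) \<subseteq> \<real>"
    by (rule spectrum_symmetric_real[OF bcl schroedinger_symmetric[OF assms]])
  show *: "closed {x. complex_of_real x \<in> spectrum (schroedinger q)}"
    using continuous_closed_vimage[OF closed_spectrum[OF bcl], of complex_of_real]
    by (simp add: vimage_def)
  show "{x. complex_of_real x \<in> spectrum (schroedinger q)} \<in> sets lebesgue"
    using * by simp
qed

end

theory Submission
  imports Defs
begin

text \<open>Cut the lattice into translates of the \<open>N \<times> M\<close> period cell. A hop \<open>y \<mapsto> y(\<cdot> + d)\<close> across a cell
  boundary, taken together with its adjoint, lies between minus and plus the diagonal operator
  that counts the two endpoints. Hence \<open>A\<^sup>- \<le> J \<le> A\<^sup>+\<close> with block diagonal operators whose blocks
  are copies of two symmetric \<open>NM \<times> NM\<close> matrices with \<open>tr A\<^sup>+ - tr A\<^sup>- = 4 (N + M)\<close>.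

  If \<open>A\<^sup>+\<close> has as many eigenvalues below \<open>x\<close> as \<open>A\<^sup>-\<close> has eigenvalues \<open>\<le> x\<close>, then the negative
  spectral subspace of \<open>A\<^sup>+ - x\<close> and the positive one of \<open>A\<^sup>- - x\<close> are complementary. Splitting \<open>u = w + v\<close>
  cellwise accordingly, \<open>J - x\<close> is positive on the \<open>w\<close>, negative on the \<open>v\<close>, and symmetric, so testing \<open>(J - x) u\<close>
  against \<open>w - v\<close> shows that \<open>J - x\<close> is bounded below; thus \<open>x\<close> is not in the spectrum. The remaining
  \<open>x\<close> have measure at most the integral of the difference of the eigenvalue counting functions,
  which is \<open>tr A\<^sup>+ - tr A\<^sup>-\<close>.\<close>

subsection \<open>Symmetric operators on the span of a finite orthonormal set\<close>

definition orthonormal :: "'a::real_inner set \<Rightarrow> bool" where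
  "orthonormal U \<longleftrightarrow> (\<forall>u\<in>U. \<forall>v\<in>U. u \<bullet> v = (if u = v then 1 else 0))"

lemma orthonormalD: "orthonormal U \<Longrightarrow> u \<in> U \<Longrightarrow> v \<in> U \<Longrightarrow> u \<bullet> v = (if u = v then 1 else 0)"
  by (simp add: orthonormal_def)

lemma orthonormal_subset: "orthonormal U \<Longrightarrow> V \<subseteq> U \<Longrightarrow> orthonormal V"
  unfolding orthonormal_def by (meson subsetD)

lemma orthonormal_inner_sum:
  assumes "finite U" "orthonormal U" "u \<in> U"
  shows "(\<Sum>v\<in>U. c v *\<^sub>R v) \<bullet> u = c u"
proof -
  have "(\<Sum>v\<in>U. c v *\<^sub>R v) \<bullet> u = (\<Sum>v\<in>U. if v = u then c v else 0)"
    unfolding inner_sum_left by (rule sum.cong) (use assms in \<open>auto simp: orthonormalD\<close>)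
  then show ?thesis using assms by simp
qed

lemma orthonormal_expand:
  assumes "finite U" "orthonormal U" "y \<in> span U"
  shows "y = (\<Sum>u\<in>U. (y \<bullet> u) *\<^sub>R u)"
proof -
  obtain c where c: "y = (\<Sum>u\<in>U. c u *\<^sub>R u)"
    using assms(1,3) by (auto simp: span_finite)
  show ?thesis
    by (subst c, rule sum.cong) (use assms c in \<open>auto simp: orthonormal_inner_sum\<close>)
qed

lemma orthonormal_inner:
  assumes "finite U" "orthonormal U" "y \<in> span U"
  shows "y \<bullet> z = (\<Sum>u\<in>U. (y \<bullet> u) * (z \<bullet> u))"
proof -
  have "y \<bullet> z = (\<Sum>u\<in>U. (y \<bullet> u) *\<^sub>R u) \<bullet> z"
    using orthonormal_expand[OF assms] by simp
  also have "\<dots> = (\<Sum>u\<in>U. (y \<bullet> u) * (z \<bullet> u))"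
    unfolding inner_sum_left by (simp add: inner_commute[of z])
  finally show ?thesis .
qed

text \<open>A vanishing combination splits into \<open>a + b = 0\<close> with \<open>a\<close> in
  \<open>span U\<close> and \<open>b\<close> in \<open>span W\<close>. Both lie in the trivial
  intersection, hence vanish, and orthonormality within each set reads off the coefficients. The two
  sets need not be orthogonal to each other.\<close>

lemma orthonormal_union_independent:
  assumes U: "finite U" "orthonormal U" and W: "finite W" "orthonormal W"
    and disj: "span U \<inter> span W \<subseteq> {0}"
  shows "independent (U \<union> W)" "U \<inter> W = {}"
proof -
  show *: "U \<inter> W = {}"
  proof (rule ccontr)
    assume "U \<inter> W \<noteq> {}"
    then obtain u where u: "u \<in> U" "u \<in> W" by blast
    then have "u \<in> span U \<inter> span W" using span_base by blast
    then have "u = 0" using disj by blast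
    with orthonormalD[OF U(2) u(1) u(1)] show False by simp
  qed
  show "independent (U \<union> W)"
  proof (rule independent_if_scalars_zero)
    show "finite (U \<union> W)" using U W by simp
    fix c x assume s: "(\<Sum>x\<in>U \<union> W. c x *\<^sub>R x) = 0" and x: "x \<in> U \<union> W"
    define a b where "a = (\<Sum>x\<in>U. c x *\<^sub>R x)" and "b = (\<Sum>x\<in>W. c x *\<^sub>R x)"
    have ab: "a = - b"
      using s * U W by (simp add: sum.union_disjoint a_def b_def eq_neg_iff_add_eq_0)
    have "a \<in> span U" "b \<in> span W"
      unfolding a_def b_def by (auto intro!: span_sum intro: span_scale span_base)
    then have "a = 0" "b = 0"
      using disj ab span_neg[of b W] by auto
    then show "c x = 0"
      using x orthonormal_inner_sum[OF U, of x c] orthonormal_inner_sum[OF W, of x c]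
      by (auto simp: a_def b_def)
  qed
qed

lemma orthonormal_independent:
  assumes "finite U" "orthonormal U"
  shows "independent U"
  using orthonormal_union_independent(1)[OF assms, of "{}"] by (simp add: orthonormal_def)

text \<open>If some \<open>b\<close> in \<open>B\<close> were missed by \<open>span D\<close>, then
  \<open>insert b D\<close> would be an independent set in \<open>span B\<close> with more than
  \<open>card B\<close> elements.\<close>

lemma span_eqI_card:
  fixes D B :: "'a::real_vector set"
  assumes "finite B" "independent D" "D \<subseteq> span B" "card B \<le> card D"
  shows "span D = span B"
proof
  show "span D \<subseteq> span B"
    using assms(3) by (simp add: span_minimal)
  have "b \<in> span D" if b: "b \<in> B" for b
  proof (rule ccontr)
    assume nb: "b \<notin> span D"
    have D: "finite D" using independent_span_bound[OF assms(1-3)] by simp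
    have "independent (insert b D)"
      using nb assms(2) by (rule independent_insertI)
    moreover have "insert b D \<subseteq> span B"
      using assms(3) b by (auto simp: span_base)
    ultimately have "card (insert b D) \<le> card B"
      using independent_span_bound[OF assms(1)] by blast
    moreover have "b \<notin> D" using nb span_base by blast
    ultimately show False using assms(4) D by simp
  qed
  then show "span B \<subseteq> span D"
    by (intro span_minimal) auto
qed

section \<open>Compactness and eigenbases of symmetric operators\<close>

text \<open>The ambient space may be infinite dimensional, so closed and bounded does not give
  compact. The image of the coefficient cube is instead built up by induction as a sum of segments.
  It serves as a compact container for the unit ball of \<open>span B\<close>.\<close>

lemma compact_unit_combinations:
  fixes B :: "'a::real_normed_vector set"
  assumes "finite B"
  shows "compact {\<Sum>b\<in>B. c b *\<^sub>R b | c. \<forall>b\<in>B. \<bar>c b\<bar> \<le> (1::real)}"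
  using assms
proof (induction B)
  case empty
  then show ?case by simp
next
  case (insert b B)
  let ?K = "\<lambda>B. {\<Sum>b\<in>B. c b *\<^sub>R b | c. \<forall>b\<in>B. \<bar>c b\<bar> \<le> (1::real)}"
  have "?K (insert b B) = {x + y | x y. x \<in> (\<lambda>t. t *\<^sub>R b) ` {-1..1} \<and> y \<in> ?K B}" (is "_ = ?S")
  proof
    show "?K (insert b B) \<subseteq> ?S"
    proof
      fix z assume "z \<in> ?K (insert b B)"
      then obtain c where c: "\<forall>x\<in>insert b B. \<bar>c x\<bar> \<le> 1"
        and z: "z = (\<Sum>x\<in>insert b B. c x *\<^sub>R x)"
        by blast
      have "z = c b *\<^sub>R b + (\<Sum>x\<in>B. c x *\<^sub>R x)" using insert.hyps z by simp
      moreover have "c b \<in> {-1..1}" using c by (auto simp: abs_le_iff)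
      ultimately show "z \<in> ?S" using c by blast
    qed
    show "?S \<subseteq> ?K (insert b B)"
    proof
      fix z assume "z \<in> ?S"
      then obtain t c where t: "-1 \<le> t" "t \<le> 1" and c: "\<forall>b\<in>B. \<bar>c b\<bar> \<le> 1"
        and z: "z = t *\<^sub>R b + (\<Sum>b\<in>B. c b *\<^sub>R b)"
        by auto
      have "(\<Sum>x\<in>B. (c(b := t)) x *\<^sub>R x) = (\<Sum>b\<in>B. c b *\<^sub>R b)"
        using insert.hyps by (intro sum.cong) auto
      then have "z = (\<Sum>x\<in>insert b B. (c(b := t)) x *\<^sub>R x)"
        using insert.hyps z by simp
      moreover have "\<forall>x\<in>insert b B. \<bar>(c(b := t)) x\<bar> \<le> 1"
        using t c by auto
      ultimately show "z \<in> ?K (insert b B)" by blast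
    qed
  qed
  moreover have "compact ((\<lambda>t. t *\<^sub>R b) ` {-1..1::real})"
    by (intro compact_continuous_image continuous_intros compact_Icc)
  ultimately show ?case
    using compact_sums[OF _ insert.IH] by simp
qed

lemma orthonormal_unit_combination:
  assumes "finite B" "orthonormal B" "y \<in> span B" "norm y \<le> 1"
  shows "y \<in> {\<Sum>b\<in>B. c b *\<^sub>R b | c. \<forall>b\<in>B. \<bar>c b\<bar> \<le> 1}"
proof -
  have "\<bar>y \<bullet> b\<bar> \<le> 1" if "b \<in> B" for b
  proof -
    have "norm b = 1"
      using orthonormalD[OF assms(2) that that] by (simp add: norm_eq_sqrt_inner)
    then show ?thesis
      using Cauchy_Schwarz_ineq2[of y b] assms(4) by simp
  qed
  then show ?thesis
    using orthonormal_expand[OF assms(1-3)] by blast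
qed

lemma linear_on_orthonormal_sum:
  assumes "linear f" "finite B" "orthonormal B" "y \<in> span B"
  shows "f y = (\<Sum>b\<in>B. (y \<bullet> b) *\<^sub>R f b)"
proof -
  have "f y = f (\<Sum>b\<in>B. (y \<bullet> b) *\<^sub>R b)"
    using orthonormal_expand[OF assms(2-4)] by simp
  also have "\<dots> = (\<Sum>b\<in>B. (y \<bullet> b) *\<^sub>R f b)"
    using assms(1) by (simp add: linear_sum linear_scale)
  finally show ?thesis .
qed

text \<open>The eigenvector is a maximiser of the quadratic form on the unit sphere of \<open>E\<close>.\<close>

lemma symmetric_eigenvector_exists:
  fixes f :: "'a::real_inner \<Rightarrow> 'a"
  assumes B: "finite B" "orthonormal B" and f: "linear f"
    and sym: "\<And>x y. x \<in> E \<Longrightarrow> y \<in> E \<Longrightarrow> f x \<bullet> y = x \<bullet> f y"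
    and E: "subspace E" "closed E" "E \<subseteq> span B" "\<And>x. x \<in> E \<Longrightarrow> f x \<in> E"
    and z: "z \<in> E" "z \<noteq> 0"
  shows "\<exists>w\<in>E. norm w = 1 \<and> (\<exists>l. f w = l *\<^sub>R w)"
proof -
  interpret f: linear f by fact
  let ?K = "{\<Sum>b\<in>B. c b *\<^sub>R b | c. \<forall>b\<in>B. \<bar>c b\<bar> \<le> (1::real)}"
  \<comment> \<open>\<open>f\<close> is only linear and not known to be continuous on the whole
    space. \<open>Q\<close> agrees with the form \<open>y \<bullet> f y\<close> on \<open>E\<close>,
    but it involves only the finitely many fixed vectors \<open>b\<close> and \<open>f b\<close>, so
    its continuity is evident.\<close>
  define Q where "Q y = (\<Sum>b\<in>B. (y \<bullet> b) * (y \<bullet> f b))" for y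
  have Q: "Q y = y \<bullet> f y" if "y \<in> E" for y
    using linear_on_orthonormal_sum[OF f B, of y] E(3) that
    by (auto simp: Q_def inner_sum_right)
  define S where "S = {y \<in> E. norm y = 1}"
  have "S = ?K \<inter> (E \<inter> sphere 0 1)"
  proof
    show "S \<subseteq> ?K \<inter> (E \<inter> sphere 0 1)"
    proof
      fix y assume "y \<in> S"
      then have "y \<in> E" "norm y = 1" by (auto simp: S_def)
      then show "y \<in> ?K \<inter> (E \<inter> sphere 0 1)"
        using orthonormal_unit_combination[OF B, of y] E(3) by auto
    qed
  qed (auto simp: S_def)
  moreover have "closed (E \<inter> sphere 0 1)" using E(2)
    by (intro closed_Int) (auto simp: sphere_def intro!: closed_Collect_eq continuous_intros)
  ultimately have "compact S"
    using compact_Int_closed[OF compact_unit_combinations[OF B(1)]] by simp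
  moreover have "(1 / norm z) *\<^sub>R z \<in> S"
    using z E(1) by (auto simp: S_def subspace_scale)
  moreover have "continuous_on S Q"
    unfolding Q_def by (intro continuous_intros)
  ultimately obtain w where w: "w \<in> S" "\<And>y. y \<in> S \<Longrightarrow> Q y \<le> Q w"
    using continuous_attains_sup[of S Q] by blast
  define l where "l = Q w"
  have wE: "w \<in> E" "norm w = 1" "w \<bullet> w = 1"
    using w(1) by (auto simp: S_def norm_eq_1)
  have nonneg: "y \<bullet> f y \<le> l * (y \<bullet> y)" if y: "y \<in> E" for y
  proof (cases "y = 0")
    case False
    have "(1 / norm y) *\<^sub>R y \<in> S"
      using False y E(1) by (auto simp: S_def subspace_scale)
    then have "Q ((1 / norm y) *\<^sub>R y) \<le> l" "(1 / norm y) *\<^sub>R y \<in> E"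
      using w(2) by (auto simp: l_def S_def)
    then have "(y \<bullet> f y) / (norm y)\<^sup>2 \<le> l"
      by (simp add: Q f.scale power2_eq_square)
    then show ?thesis
      using False by (simp add: field_simps power2_norm_eq_inner)
  qed (simp add: f.zero)
  \<comment> \<open>The residual of the eigenvalue equation at the maximiser. Moving from
    \<open>w\<close> in this direction changes \<open>l * (z \<bullet> z) - z \<bullet> f z\<close>,
    which is nonnegative and zero at \<open>w\<close>, by \<open>2 * t * a + t\<^sup>2 * c\<close>;
    a nonzero linear coefficient would make this negative for some \<open>t\<close>.\<close>
  define y where "y = l *\<^sub>R w - f w"
  have y: "y \<in> E"
    using wE E by (simp add: y_def subspace_diff subspace_scale)
  define a c where "a = y \<bullet> y" and "c = l * (y \<bullet> y) - y \<bullet> f y"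
  have c: "0 \<le> c" using nonneg[OF y] by (simp add: c_def)
  have lw: "l = w \<bullet> f w" using Q[OF wE(1)] by (simp add: l_def)
  have "0 \<le> 2 * t * a + t\<^sup>2 * c" for t
  proof -
    have "w + t *\<^sub>R y \<in> E" using wE y E(1) by (simp add: subspace_add subspace_scale)
    from nonneg[OF this]
    have "0 \<le> l * ((w + t *\<^sub>R y) \<bullet> (w + t *\<^sub>R y)) - (w + t *\<^sub>R y) \<bullet> f (w + t *\<^sub>R y)"
      by simp
    also have "\<dots> = (l * (w \<bullet> w) - w \<bullet> f w) + t * (2 * l * (w \<bullet> y) - y \<bullet> f w - w \<bullet> f y) + t\<^sup>2 * c"
      by (simp add: f.add f.scale inner_add_left inner_add_right c_def power2_eq_square
          inner_commute[of y w] algebra_simps)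
    also have "w \<bullet> f y = y \<bullet> f w"
      using sym[OF wE(1) y] by (simp add: inner_commute)
    also have "2 * l * (w \<bullet> y) - y \<bullet> f w - y \<bullet> f w = 2 * a"
    proof -
      have "a = (l *\<^sub>R w - f w) \<bullet> y" by (simp add: a_def y_def)
      also have "\<dots> = l * (w \<bullet> y) - y \<bullet> f w" unfolding inner_diff_left by (simp add: inner_commute[of "f w"])
      finally show ?thesis by simp
    qed
    finally show ?thesis
      using lw wE(3) by (simp add: mult_ac)
  qed
  \<comment> \<open>The minimiser would be \<open>t = - a / c\<close>; the denominator
    \<open>c + 1\<close> also covers \<open>c = 0\<close> and still gives a negative value unless
    \<open>a = 0\<close>.\<close>
  from this[of "- (a / (c + 1))"]
  have "0 \<le> - (2 * a\<^sup>2 / (c + 1)) + a\<^sup>2 * c / (c + 1)\<^sup>2"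
    by (simp add: power2_eq_square)
  also have "\<dots> = - (a\<^sup>2 * (c + 2) / (c + 1)\<^sup>2)"
    using c by (simp add: divide_simps) (simp add: power2_eq_square algebra_simps)
  finally have "a\<^sup>2 * (c + 2) / (c + 1)\<^sup>2 \<le> 0" by simp
  then have "a = 0"
    using c by (auto simp: divide_le_0_iff mult_le_0_iff)
  then have "f w = l *\<^sub>R w" by (simp add: a_def y_def)
  then show ?thesis using wE by blast
qed

text \<open>Take an orthonormal set of eigenvectors in \<open>span B\<close> of maximal size. Its
  orthogonal complement in \<open>span B\<close> is invariant because \<open>f\<close> is symmetric,
  so if it were nonzero it would contain a further unit eigenvector. Each eigenvalue is recorded as
  the Rayleigh quotient \<open>u \<bullet> f u\<close>.\<close>

lemma symmetric_eigenbasis_exists: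
  fixes f :: "'a::real_inner \<Rightarrow> 'a"
  assumes B: "finite B" "orthonormal B" and f: "linear f"
    and sym: "\<And>x y. x \<in> span B \<Longrightarrow> y \<in> span B \<Longrightarrow> f x \<bullet> y = x \<bullet> f y"
    and inv: "\<And>x. x \<in> span B \<Longrightarrow> f x \<in> span B"
  obtains U where "finite U" "orthonormal U" "span U = span B" "\<And>u. u \<in> U \<Longrightarrow> f u = (u \<bullet> f u) *\<^sub>R u"
proof -
  interpret f: linear f by fact
  define good where "good U \<longleftrightarrow> finite U \<and> orthonormal U \<and> U \<subseteq> span B \<and> (\<forall>u\<in>U. f u = (u \<bullet> f u) *\<^sub>R u)"
    for U
  have bound: "card U \<le> card B" if "good U" for U
    using that independent_span_bound[OF B(1)] orthonormal_independent[of U] by (auto simp: good_def)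
  have "good {}" by (simp add: good_def orthonormal_def)
  then obtain U where U: "good U" and mx: "\<And>V. good V \<Longrightarrow> card V \<le> card U"
    using ex_has_greatest_nat[of good "{}" card "Suc (card B)"] bound by (metis less_Suc_eq_le)
  have Uf: "finite U" "orthonormal U" "U \<subseteq> span B" using U by (auto simp: good_def)
  define E where "E = {y \<in> span B. \<forall>u\<in>U. y \<bullet> u = 0}"
  have "span U = span B"
  proof (rule ccontr)
    assume "span U \<noteq> span B"
    then obtain x where x: "x \<in> span B" "x \<notin> span U"
      using Uf(3) span_minimal[of U "span B"] by auto
    \<comment> \<open>Removing from \<open>x\<close> its projection onto \<open>span U\<close>
      leaves a nonzero element of the complement \<open>E\<close>.\<close>
    define z where "z = x - (\<Sum>u\<in>U. (x \<bullet> u) *\<^sub>R u)"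
    have s: "(\<Sum>u\<in>U. (x \<bullet> u) *\<^sub>R u) \<in> span U"
      by (auto intro!: span_sum intro: span_scale span_base)
    then have z0: "z \<noteq> 0" using x by (auto simp: z_def)
    have "(\<Sum>u\<in>U. (x \<bullet> u) *\<^sub>R u) \<in> span B"
      using s Uf(3) span_minimal[of U "span B"] by auto
    then have zE: "z \<in> E"
      using x Uf by (auto simp: E_def z_def span_diff inner_diff_left orthonormal_inner_sum)
    have "\<exists>w\<in>E. norm w = 1 \<and> (\<exists>l. f w = l *\<^sub>R w)"
    proof (rule symmetric_eigenvector_exists[OF B f _ _ _ _ _ zE z0])
      show "subspace E"
        by (auto simp: E_def subspace_def span_add span_scale span_zero inner_add_left)
      \<comment> \<open>The span is the zero set of the continuous map sending a vector to its
        difference from its projection.\<close>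
      have "closed (span B)"
      proof -
        have "span B = {y. y - (\<Sum>b\<in>B. (y \<bullet> b) *\<^sub>R b) = 0}" (is "_ = ?R")
        proof
          show "span B \<subseteq> ?R" using orthonormal_expand[OF B] by auto
          show "?R \<subseteq> span B"
          proof
            fix y assume "y \<in> ?R"
            then have "y = (\<Sum>b\<in>B. (y \<bullet> b) *\<^sub>R b)" by simp
            also have "\<dots> \<in> span B" by (auto intro!: span_sum intro: span_scale span_base)
            finally show "y \<in> span B" .
          qed
        qed
        moreover have "closed ?R"
          by (intro closed_Collect_eq continuous_intros)
        ultimately show ?thesis by simp
      qed
      moreover have "E = span B \<inter> (\<Inter>u\<in>U. {y. y \<bullet> u = 0})"
        by (auto simp: E_def)
      moreover have "closed {y::'a. y \<bullet> u = 0}" for u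
        by (intro closed_Collect_eq continuous_intros)
      ultimately show "closed E" by (auto intro!: closed_Int closed_INT)
      show "f y \<in> E" if "y \<in> E" for y
      proof -
        have "f y \<bullet> u = 0" if u: "u \<in> U" for u
        proof -
          have "f y \<bullet> u = y \<bullet> f u"
            using sym[of y u] \<open>y \<in> E\<close> u Uf(3) by (auto simp: E_def)
          also have "f u = (u \<bullet> f u) *\<^sub>R u" using U u by (simp add: good_def)
          finally show ?thesis using \<open>y \<in> E\<close> u by (simp add: E_def)
        qed
        then show ?thesis using that inv by (auto simp: E_def)
      qed
    qed (use sym in \<open>auto simp: E_def\<close>)
    then obtain w l where w: "w \<in> E" "norm w = 1" "f w = l *\<^sub>R w" by blast
    have ww: "w \<bullet> w = 1" using w(2) by (simp add: norm_eq_1)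
    have "w \<notin> U" using w(1) ww by (auto simp: E_def)
    moreover have "good (insert w U)"
      using w ww U by (auto simp: good_def E_def orthonormal_def inner_commute)
    ultimately show False using mx[of "insert w U"] Uf(1) by simp
  qed
  then show ?thesis using that U by (auto simp: good_def)
qed

section \<open>Forms and traces in an eigenbasis; eigenvalue counting for an ordered pair\<close>

lemma eigenvector_form_diagonal:
  fixes f :: "'a::real_inner \<Rightarrow> 'a"
  assumes U: "finite U" "orthonormal U" and f: "linear f"
    and eig: "\<And>u. u \<in> U \<Longrightarrow> f u = (u \<bullet> f u) *\<^sub>R u" and y: "y \<in> span U"
  shows "y \<bullet> f y = (\<Sum>u\<in>U. (u \<bullet> f u) * (y \<bullet> u)\<^sup>2)"
proof -
  have "y \<bullet> f y = (\<Sum>u\<in>U. (y \<bullet> u) * (y \<bullet> f u))"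
    by (subst linear_on_orthonormal_sum[OF f U y]) (simp add: inner_sum_right)
  also have "\<dots> = (\<Sum>u\<in>U. (u \<bullet> f u) * (y \<bullet> u)\<^sup>2)"
  proof (rule sum.cong[OF refl])
    fix u assume "u \<in> U"
    have "y \<bullet> f u = (u \<bullet> f u) * (y \<bullet> u)"
      by (subst eig[OF \<open>u \<in> U\<close>]) simp
    then show "(y \<bullet> u) * (y \<bullet> f u) = (u \<bullet> f u) * (y \<bullet> u)\<^sup>2"
      by (simp add: power2_eq_square)
  qed
  finally show ?thesis .
qed

lemma eigenvector_form_lower:
  fixes f :: "'a::real_inner \<Rightarrow> 'a"
  assumes U: "finite U" "orthonormal U" and f: "linear f"
    and eig: "\<And>u. u \<in> U \<Longrightarrow> f u = (u \<bullet> f u) *\<^sub>R u" and y: "y \<in> span U"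
    and l: "\<And>u. u \<in> U \<Longrightarrow> l \<le> u \<bullet> f u"
  shows "l * (y \<bullet> y) \<le> y \<bullet> f y"
proof -
  have "y \<bullet> f y = (\<Sum>u\<in>U. (u \<bullet> f u) * (y \<bullet> u)\<^sup>2)"
    by (rule eigenvector_form_diagonal[OF U f _ y]) (rule eig)
  then show ?thesis
    unfolding orthonormal_inner[OF U y, of y] sum_distrib_left power2_eq_square
    by (auto intro!: sum_mono mult_right_mono l)
qed

lemma eigenvector_form_upper:
  fixes f :: "'a::real_inner \<Rightarrow> 'a"
  assumes U: "finite U" "orthonormal U" and f: "linear f"
    and eig: "\<And>u. u \<in> U \<Longrightarrow> f u = (u \<bullet> f u) *\<^sub>R u" and y: "y \<in> span U"
    and l: "\<And>u. u \<in> U \<Longrightarrow> u \<bullet> f u \<le> l"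
  shows "y \<bullet> f y \<le> l * (y \<bullet> y)"
proof -
  have "y \<bullet> f y = (\<Sum>u\<in>U. (u \<bullet> f u) * (y \<bullet> u)\<^sup>2)"
    by (rule eigenvector_form_diagonal[OF U f _ y]) (rule eig)
  then show ?thesis
    unfolding orthonormal_inner[OF U y, of y] sum_distrib_left power2_eq_square
    by (auto intro!: sum_mono mult_right_mono l)
qed

text \<open>Expand \<open>u \<bullet> f u\<close> in \<open>B\<close>, swap the two sums, move
  \<open>f\<close> across by symmetry, and collapse the sum over \<open>U\<close> by the expansion
  in the other basis.\<close>

lemma trace_orthonormal_eq:
  fixes f :: "'a::real_inner \<Rightarrow> 'a"
  assumes U: "finite U" "orthonormal U" and B: "finite B" "orthonormal B"
    and eq: "span U = span B"
    and sym: "\<And>x y. x \<in> span B \<Longrightarrow> y \<in> span B \<Longrightarrow> f x \<bullet> y = x \<bullet> f y"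
    and inv: "\<And>x. x \<in> span B \<Longrightarrow> f x \<in> span B"
  shows "(\<Sum>u\<in>U. u \<bullet> f u) = (\<Sum>b\<in>B. b \<bullet> f b)"
proof -
  have UB: "u \<in> span B" if "u \<in> U" for u using that eq span_base by blast
  have "(\<Sum>u\<in>U. u \<bullet> f u) = (\<Sum>u\<in>U. \<Sum>b\<in>B. (u \<bullet> b) * (f u \<bullet> b))"
    by (rule sum.cong[OF refl], rule orthonormal_inner[OF B UB])
  also have "\<dots> = (\<Sum>b\<in>B. \<Sum>u\<in>U. (u \<bullet> b) * (f u \<bullet> b))"
    by (rule sum.swap)
  also have "\<dots> = (\<Sum>b\<in>B. \<Sum>u\<in>U. (b \<bullet> u) * (f b \<bullet> u))"
    by (intro sum.cong refl arg_cong2[where f = "(*)"])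
      (use sym UB span_base[of _ B] in \<open>auto simp: inner_commute\<close>)
  also have "\<dots> = (\<Sum>b\<in>B. b \<bullet> f b)"
    by (rule sum.cong[OF refl], rule orthonormal_inner[OF U, symmetric]) (simp add: eq span_base)
  finally show ?thesis .
qed

text \<open>The exceptional set consists of those \<open>x\<close> for which the number of eigenvalues of \<open>f\<close> in
  \<open>(-\<infinity>, x]\<close> differs from that of \<open>g\<close> in \<open>(-\<infinity>, x)\<close>; the difference of the two counting functions
  is a nonnegative integer and its integral is the difference of the traces.\<close>

lemma ordered_symmetric_pair_splitting:
  fixes f g :: "'a::real_inner \<Rightarrow> 'a"
  assumes B: "finite B" "orthonormal B" and f: "linear f" and g: "linear g"
    and symf: "\<And>x y. x \<in> span B \<Longrightarrow> y \<in> span B \<Longrightarrow> f x \<bullet> y = x \<bullet> f y"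
    and symg: "\<And>x y. x \<in> span B \<Longrightarrow> y \<in> span B \<Longrightarrow> g x \<bullet> y = x \<bullet> g y"
    and invf: "\<And>x. x \<in> span B \<Longrightarrow> f x \<in> span B"
    and invg: "\<And>x. x \<in> span B \<Longrightarrow> g x \<in> span B"
    and le: "\<And>x. x \<in> span B \<Longrightarrow> x \<bullet> f x \<le> x \<bullet> g x"
  obtains X where "X \<in> sets borel"
    "emeasure lborel X \<le> ennreal ((\<Sum>b\<in>B. b \<bullet> g b) - (\<Sum>b\<in>B. b \<bullet> f b))"
    "\<And>x. x \<notin> X \<Longrightarrow> \<exists>\<delta>>0. \<exists>P. linear P \<and> (\<forall>y\<in>span B. P y \<in> span B
      \<and> (x + \<delta>) * (P y \<bullet> P y) \<le> P y \<bullet> f (P y)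
      \<and> (y - P y) \<bullet> g (y - P y) \<le> (x - \<delta>) * ((y - P y) \<bullet> (y - P y)))"
proof -
  obtain U where U: "finite U" "orthonormal U" "span U = span B"
    and eigU: "\<And>u. u \<in> U \<Longrightarrow> f u = (u \<bullet> f u) *\<^sub>R u"
    using symmetric_eigenbasis_exists[OF B f symf invf] by metis
  obtain W where W: "finite W" "orthonormal W" "span W = span B"
    and eigW: "\<And>w. w \<in> W \<Longrightarrow> g w = (w \<bullet> g w) *\<^sub>R w"
    using symmetric_eigenbasis_exists[OF B g symg invg] by metis
  define \<alpha> \<beta> where "\<alpha> u = u \<bullet> f u" and "\<beta> w = w \<bullet> g w" for u w
  have card: "card V = card B" if "finite V" "orthonormal V" "span V = span B" for V
    by (metis B orthonormal_independent that dim_span_eq_card_independent)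
  \<comment> \<open>Here \<open>f\<close> plays the role of the lower operator and \<open>g\<close>
    of the upper one: these eigenvectors span the positive spectral subspace of \<open>f - x\<close>
    and the negative one of \<open>g - x\<close>.\<close>
  define Ux Wx where "Ux x = {u\<in>U. x < \<alpha> u}" and "Wx x = {w\<in>W. \<beta> w < x}" for x
  have UWx: "finite (Ux x)" "orthonormal (Ux x)" "finite (Wx x)" "orthonormal (Wx x)"
    "Ux x \<subseteq> U" "Wx x \<subseteq> W" for x
    using U W orthonormal_subset[of U "Ux x"] orthonormal_subset[of W "Wx x"]
    by (auto simp: Ux_def Wx_def)
  have spanB: "span (Ux x) \<subseteq> span B" "span (Wx x) \<subseteq> span B" for x
    using span_mono[OF UWx(5)] span_mono[OF UWx(6)] U W by auto
  have gap: "\<exists>\<delta>>0. (\<forall>y\<in>span (Ux x). (x + \<delta>) * (y \<bullet> y) \<le> y \<bullet> f y)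
      \<and> (\<forall>y\<in>span (Wx x). y \<bullet> g y \<le> (x - \<delta>) * (y \<bullet> y))" for x
  proof -
    \<comment> \<open>The distances from \<open>x\<close> to the relevant eigenvalues. The element 1
      keeps the set nonempty, so that its minimum is a valid gap even when there are no such
      eigenvalues.\<close>
    define G where "G = insert 1 ((\<lambda>u. \<alpha> u - x) ` Ux x \<union> (\<lambda>w. x - \<beta> w) ` Wx x)"
    have G: "finite G" "G \<noteq> {}" "\<forall>t\<in>G. 0 < t"
      using UWx by (auto simp: G_def Ux_def Wx_def)
    have "0 < Min G" using G by simp
    moreover have "(x + Min G) * (y \<bullet> y) \<le> y \<bullet> f y" if "y \<in> span (Ux x)" for y
    proof (rule eigenvector_form_lower[OF UWx(1,2) f _ that])
      fix u assume u: "u \<in> Ux x"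
      show "f u = (u \<bullet> f u) *\<^sub>R u" using u UWx(5) eigU by blast
      have "Min G \<le> \<alpha> u - x" using u G by (intro Min_le) (auto simp: G_def)
      then show "x + Min G \<le> u \<bullet> f u" by (simp add: \<alpha>_def)
    qed
    moreover have "y \<bullet> g y \<le> (x - Min G) * (y \<bullet> y)" if "y \<in> span (Wx x)" for y
    proof (rule eigenvector_form_upper[OF UWx(3,4) g _ that])
      fix w assume w: "w \<in> Wx x"
      show "g w = (w \<bullet> g w) *\<^sub>R w" using w UWx(6) eigW by blast
      have "Min G \<le> x - \<beta> w" using w G by (intro Min_le) (auto simp: G_def)
      then show "w \<bullet> g w \<le> x - Min G" by (simp add: \<beta>_def)
    qed
    ultimately show ?thesis by blast
  qed
  \<comment> \<open>On a common vector, \<open>(x + \<delta>) * (y \<bullet> y) \<le> y \<bullet> f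
    y \<le> y \<bullet> g y \<le> (x - \<delta>) * (y \<bullet> y)\<close>, which forces
    \<open>y = 0\<close>.\<close>
  have disj: "span (Ux x) \<inter> span (Wx x) \<subseteq> {0}" for x
  proof
    fix y assume y: "y \<in> span (Ux x) \<inter> span (Wx x)"
    obtain \<delta> where d: "\<delta> > 0" "(x + \<delta>) * (y \<bullet> y) \<le> y \<bullet> f y" "y \<bullet> g y \<le> (x - \<delta>) * (y \<bullet> y)"
      using gap[of x] y by blast
    have "y \<bullet> f y \<le> y \<bullet> g y" using le y spanB by blast
    then have "2 * \<delta> * (y \<bullet> y) \<le> 0" using d by (simp add: algebra_simps)
    then have "y \<bullet> y \<le> 0" using d(1) by (simp add: mult_le_0_iff)
    then show "y \<in> {0}" using inner_ge_zero[of y] by (simp add: order_antisym_conv)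
  qed
  have ind: "independent (Ux x \<union> Wx x)" "Ux x \<inter> Wx x = {}" "Ux x \<union> Wx x \<subseteq> span B" for x
    using orthonormal_union_independent[OF UWx(1-4) disj] spanB span_base by blast+
  define p r where "p x = card {u\<in>U. \<alpha> u \<le> x}" and "r x = card (Wx x)" for x
  have cU: "card (Ux x) + p x = card B" for x
  proof -
    have "card (Ux x \<union> {u\<in>U. \<alpha> u \<le> x}) = card (Ux x) + p x"
      unfolding p_def using U UWx by (intro card_Un_disjoint) (auto simp: Ux_def)
    moreover have "Ux x \<union> {u\<in>U. \<alpha> u \<le> x} = U" by (auto simp: Ux_def)
    ultimately show ?thesis using card[OF U] by simp
  qed
  have cD: "card (Ux x \<union> Wx x) = card (Ux x) + r x" for x
    unfolding r_def using UWx ind by (intro card_Un_disjoint) auto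
  \<comment> \<open>The independent union has \<open>card B - p x + r x\<close> elements, which
    cannot exceed \<open>card B\<close>.\<close>
  have rp: "r x \<le> p x" for x
    using independent_span_bound[OF B(1) ind(1,3)] cU[of x] cD[of x] by (metis add_le_cancel_left)
  obtain L where L: "\<And>u. u \<in> U \<Longrightarrow> \<alpha> u \<le> L" "\<And>w. w \<in> W \<Longrightarrow> \<beta> w \<le> L"
  proof -
    define S where "S = insert 0 (\<alpha> ` U \<union> \<beta> ` W)"
    have "finite S" using U W by (simp add: S_def)
    then show ?thesis using that[of "Max S"] by (auto simp: S_def)
  qed
  \<comment> \<open>Cutting off at \<open>L\<close> makes every indicator integrable and loses
    nothing: beyond \<open>L\<close> both counts equal \<open>card B\<close> and cancel. The left
    endpoints match the counts: closed for \<open>\<alpha> u \<le> x\<close>, open for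
    \<open>\<beta> w < x\<close>.\<close>
  define h where "h x = (\<Sum>u\<in>U. indicator {\<alpha> u..L} x) - (\<Sum>w\<in>W. indicator {\<beta> w<..L} x :: real)" for x
  have h: "h x = real (p x) - real (r x)" for x
  proof (cases "x \<le> L")
    case True
    have "(\<Sum>u\<in>U. indicator {\<alpha> u..L} x) = (\<Sum>u\<in>U. if \<alpha> u \<le> x then 1 else 0 :: real)"
      using True by (intro sum.cong) (auto simp: indicator_def)
    moreover have "(\<Sum>w\<in>W. indicator {\<beta> w<..L} x) = (\<Sum>w\<in>W. if \<beta> w < x then 1 else 0 :: real)"
      using True by (intro sum.cong) (auto simp: indicator_def)
    ultimately show ?thesis
      using U W by (simp add: h_def p_def r_def Wx_def sum.If_cases Int_def)
  next
    case False
    then have "{u\<in>U. \<alpha> u \<le> x} = U" "Wx x = W" using L by (fastforce simp: Wx_def)+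
    then have "p x = r x" using card[OF U] card[OF W] by (simp add: p_def r_def)
    moreover have "h x = 0" using False by (simp add: h_def)
    ultimately show ?thesis by simp
  qed
  define X where "X = {x. h x \<noteq> 0}"
  have hb[measurable]: "h \<in> borel_measurable borel"
    unfolding h_def by measurable
  have Xb: "X \<in> sets borel"
    unfolding X_def by measurable
  have hi: "has_bochner_integral lborel h ((\<Sum>u\<in>U. L - \<alpha> u) - (\<Sum>w\<in>W. L - \<beta> w))"
    unfolding h_def
  proof (intro has_bochner_integral_diff has_bochner_integral_sum)
    show "has_bochner_integral lborel (indicator {\<alpha> u..L}) (L - \<alpha> u)" if "u \<in> U" for u
      using has_bochner_integral_real_indicator[of "{\<alpha> u..L}" lborel] L(1)[OF that]
      by simp
    show "has_bochner_integral lborel (indicator {\<beta> w<..L}) (L - \<beta> w)" if "w \<in> W" for w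
      using has_bochner_integral_real_indicator[of "{\<beta> w<..L}" lborel] L(2)[OF that]
      by simp
  qed
  \<comment> \<open>\<open>L\<close> cancels because both eigenbases have \<open>card B\<close>
    elements; what remains is the difference of traces.\<close>
  have tr: "(\<Sum>u\<in>U. L - \<alpha> u) - (\<Sum>w\<in>W. L - \<beta> w) = (\<Sum>b\<in>B. b \<bullet> g b) - (\<Sum>b\<in>B. b \<bullet> f b)"
    using trace_orthonormal_eq[OF U(1,2) B U(3) symf invf]
      trace_orthonormal_eq[OF W(1,2) B W(3) symg invg] card[OF U] card[OF W]
    by (simp add: sum_subtractf \<alpha>_def \<beta>_def)
  \<comment> \<open>\<open>h\<close> is a nonnegative integer at every point, so it is at least 1 on
    \<open>X\<close> and dominates the indicator.\<close>
  have "emeasure lborel X = (\<integral>\<^sup>+x. indicator X x \<partial>lborel)"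
    using Xb by simp
  also have "\<dots> \<le> (\<integral>\<^sup>+x. ennreal (h x) \<partial>lborel)"
  proof (rule nn_integral_mono)
    fix x
    show "indicator X x \<le> ennreal (h x)"
    proof (cases "x \<in> X")
      case True
      then have "p x \<noteq> r x" using h[of x] by (auto simp: X_def)
      then have "1 \<le> h x" using rp[of x] h[of x] by linarith
      then show ?thesis using True by simp
    qed simp
  qed
  also have "\<dots> = ennreal (integral\<^sup>L lborel h)"
  proof (rule nn_integral_eq_integral)
    show "integrable lborel h" using hi by (simp add: has_bochner_integral_iff)
    show "AE x in lborel. 0 \<le> h x" using rp by (simp add: h)
  qed
  also have "integral\<^sup>L lborel h = (\<Sum>b\<in>B. b \<bullet> g b) - (\<Sum>b\<in>B. b \<bullet> f b)"
    using hi tr by (simp add: has_bochner_integral_iff)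
  finally have meas: "emeasure lborel X \<le> ennreal ((\<Sum>b\<in>B. b \<bullet> g b) - (\<Sum>b\<in>B. b \<bullet> f b))" .
  have split: "\<exists>\<delta>>0. \<exists>P. linear P \<and> (\<forall>y\<in>span B. P y \<in> span B
      \<and> (x + \<delta>) * (P y \<bullet> P y) \<le> P y \<bullet> f (P y)
      \<and> (y - P y) \<bullet> g (y - P y) \<le> (x - \<delta>) * ((y - P y) \<bullet> (y - P y)))" if "x \<notin> X" for x
  proof -
    let ?D = "Ux x \<union> Wx x"
    have "p x = r x" using that h[of x] by (simp add: X_def)
    then have "card ?D = card B" using cU[of x] cD[of x] by simp
    then have spanD: "span ?D = span B"
      using span_eqI_card[OF B(1) ind(1,3)] by simp
    \<comment> \<open>Equal counts make \<open>?D\<close> a basis of \<open>span B\<close>. On that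
      span \<open>P\<close> is the oblique projection onto \<open>span (Ux x)\<close> along
      \<open>span (Wx x)\<close>.\<close>
    obtain P where P: "linear P" "\<And>d. d \<in> ?D \<Longrightarrow> P d = (if d \<in> Ux x then d else 0)"
      using linear_independent_extend[OF ind(1)[of x], of "\<lambda>d. if d \<in> Ux x then d else 0"] by blast
    interpret P: linear P by (rule P(1))
    have dec: "P y \<in> span (Ux x) \<and> y - P y \<in> span (Wx x)" if y: "y \<in> span ?D" for y
    proof -
      have "subspace {y. P y \<in> span (Ux x) \<and> y - P y \<in> span (Wx x)}"
      proof (rule subspaceI)
        fix a b c assume ab: "a \<in> {y. P y \<in> span (Ux x) \<and> y - P y \<in> span (Wx x)}"
          "b \<in> {y. P y \<in> span (Ux x) \<and> y - P y \<in> span (Wx x)}"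
        have "(a - P a) + (b - P b) \<in> span (Wx x)" using ab by (intro span_add) auto
        moreover have "(a - P a) + (b - P b) = (a + b) - P (a + b)"
          by (simp add: P.add)
        ultimately show "a + b \<in> {y. P y \<in> span (Ux x) \<and> y - P y \<in> span (Wx x)}"
          using ab by (simp add: P.add span_add)
      next
        fix a c assume a: "a \<in> {y. P y \<in> span (Ux x) \<and> y - P y \<in> span (Wx x)}"
        have "c *\<^sub>R (a - P a) \<in> span (Wx x)" using a by (intro span_scale) auto
        then show "c *\<^sub>R a \<in> {y. P y \<in> span (Ux x) \<and> y - P y \<in> span (Wx x)}"
          using a by (simp add: P.scale span_scale scaleR_diff_right)
      qed (simp add: P.zero span_zero)
      moreover have "d \<in> {y. P y \<in> span (Ux x) \<and> y - P y \<in> span (Wx x)}" if "d \<in> ?D" for d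
        using P(2)[OF that] that ind(2)[of x] by (auto simp: span_base span_zero)
      ultimately show ?thesis
        using span_induct[OF y, of "\<lambda>y. P y \<in> span (Ux x) \<and> y - P y \<in> span (Wx x)"]
        by (simp add: Collect_conj_eq)
    qed
    obtain \<delta> where d: "\<delta> > 0" "\<forall>y\<in>span (Ux x). (x + \<delta>) * (y \<bullet> y) \<le> y \<bullet> f y"
      "\<forall>y\<in>span (Wx x). y \<bullet> g y \<le> (x - \<delta>) * (y \<bullet> y)"
      using gap[of x] by blast
    show ?thesis
    proof (intro exI[of _ \<delta>] exI[of _ P] conjI ballI d(1) P(1))
      fix y assume "y \<in> span B"
      then have "P y \<in> span (Ux x)" "y - P y \<in> span (Wx x)" using dec spanD by auto
      then show "P y \<in> span B" "(x + \<delta>) * (P y \<bullet> P y) \<le> P y \<bullet> f (P y)"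
        "(y - P y) \<bullet> g (y - P y) \<le> (x - \<delta>) * ((y - P y) \<bullet> (y - P y))"
        using d spanB by blast+
    qed
  qed
  show thesis by (rule that[OF Xb meas split])
qed

subsection \<open>Ordered pairs of symmetric kernels\<close>

definition quadratic_form :: "'a set \<Rightarrow> ('a \<Rightarrow> 'a \<Rightarrow> real) \<Rightarrow> ('a \<Rightarrow> real) \<Rightarrow> real" where
  "quadratic_form C a f = (\<Sum>i\<in>C. \<Sum>j\<in>C. a i j * f i * f j)"

text \<open>The coordinate vectors. Their real span over a finite index set is the inner product
  space in which real symmetric kernels are treated as operators.\<close>

lift_definition unit_ell2 :: "'a \<Rightarrow> 'a ell2" is "\<lambda>i j. if j = i then 1 else 0"
proof -
  fix i :: 'a
  have "(\<Sum>j\<in>F. (cmod (if j = i then 1 else 0))\<^sup>2) \<le> 1" if "finite F" for F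
  proof -
    have "(\<Sum>j\<in>F. (cmod (if j = i then 1 else 0))\<^sup>2) = (\<Sum>j\<in>F. if j = i then 1 else 0)"
      by (rule sum.cong) auto
    then show ?thesis using that by simp
  qed
  then show "sq_summable (\<lambda>j. if j = i then 1 else 0)" by (rule sq_summableI_bound)
qed

lemma inner_unit_ell2: "unit_ell2 i \<bullet> unit_ell2 j = (if i = j then 1 else 0)"
proof -
  have "unit_ell2 i \<bullet> unit_ell2 j = (\<Sum>\<^sub>\<infinity>k\<in>{i}. if i = j then 1 else 0)"
    unfolding inner_ell2.rep_eq unit_ell2.rep_eq by (rule infsum_cong_neutral) auto
  then show ?thesis by simp
qed

lemma inj_unit_ell2: "inj_on unit_ell2 C"
  by (rule inj_onI) (metis inner_unit_ell2 zero_neq_one)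

lemma orthonormal_unit_ell2: "orthonormal (unit_ell2 ` C)"
  using inj_unit_ell2[of UNIV] by (auto simp: orthonormal_def inner_unit_ell2 inj_on_def)

text \<open>The matrix version of the preceding splitting: kernels act on the real span of the
  coordinate vectors of \<open>C\<close>, and traces become sums of diagonal entries. Having
  \<open>P\<close> as a real matrix allows the same splitting to be used in every cell, for real and
  imaginary parts alike.\<close>

lemma ordered_kernel_pair_splitting:
  fixes a b :: "'a \<Rightarrow> 'a \<Rightarrow> real"
  assumes C: "finite C"
    and syma: "\<And>i j. i \<in> C \<Longrightarrow> j \<in> C \<Longrightarrow> a i j = a j i"
    and symb: "\<And>i j. i \<in> C \<Longrightarrow> j \<in> C \<Longrightarrow> b i j = b j i"
    and le: "\<And>f. quadratic_form C a f \<le> quadratic_form C b f"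
  obtains X where "X \<in> sets borel"
    "emeasure lborel X \<le> ennreal (\<Sum>i\<in>C. b i i - a i i)"
    "\<And>x. x \<notin> X \<Longrightarrow> \<exists>\<delta>>0. \<exists>P::'a \<Rightarrow> 'a \<Rightarrow> real. \<forall>f.
      (x + \<delta>) * (\<Sum>i\<in>C. (\<Sum>j\<in>C. P i j * f j)\<^sup>2) \<le> quadratic_form C a (\<lambda>i. \<Sum>j\<in>C. P i j * f j)
      \<and> quadratic_form C b (\<lambda>i. f i - (\<Sum>j\<in>C. P i j * f j))
        \<le> (x - \<delta>) * (\<Sum>i\<in>C. (f i - (\<Sum>j\<in>C. P i j * f j))\<^sup>2)"
proof -
  let ?e = "unit_ell2 :: 'a \<Rightarrow> 'a ell2"
  define B where "B = ?e ` C"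
  have B: "finite B" "orthonormal B"
    using C by (auto simp: B_def orthonormal_unit_ell2)
  have eB: "?e i \<in> span B" if "i \<in> C" for i using that by (auto simp: B_def span_base)
  define opr where "opr k x = (\<Sum>i\<in>C. \<Sum>j\<in>C. (k i j * (x \<bullet> ?e j)) *\<^sub>R ?e i)"
    for k :: "'a \<Rightarrow> 'a \<Rightarrow> real" and x
  have opr_lin: "linear (opr k)" for k
    by (rule linearI)
      (simp_all add: opr_def inner_add_left distrib_left scaleR_left_distrib sum.distrib
        scaleR_sum_right mult.left_commute)
  have opr_inv: "opr k x \<in> span B" for k x
    unfolding opr_def by (intro span_sum span_scale eB)
  have opr_inner: "y \<bullet> opr k x = (\<Sum>i\<in>C. \<Sum>j\<in>C. k i j * (y \<bullet> ?e i) * (x \<bullet> ?e j))" for k x y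
    by (simp add: opr_def inner_sum_right mult_ac)
  have opr_form: "x \<bullet> opr k x = quadratic_form C k (\<lambda>i. x \<bullet> ?e i)" for k x
    by (simp add: opr_inner quadratic_form_def)
  have opr_sym: "opr k x \<bullet> y = x \<bullet> opr k y"
    if "\<And>i j. i \<in> C \<Longrightarrow> j \<in> C \<Longrightarrow> k i j = k j i" for k x y
  proof -
    have "opr k x \<bullet> y = (\<Sum>i\<in>C. \<Sum>j\<in>C. k i j * (y \<bullet> ?e i) * (x \<bullet> ?e j))"
      by (simp add: inner_commute[of _ y] opr_inner)
    also have "\<dots> = (\<Sum>j\<in>C. \<Sum>i\<in>C. k i j * (y \<bullet> ?e i) * (x \<bullet> ?e j))"
      by (rule sum.swap)
    also have "\<dots> = x \<bullet> opr k y"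
      unfolding opr_inner by (intro sum.cong refl) (use that in simp)
    finally show ?thesis .
  qed
  have opr_diag: "?e l \<bullet> opr k (?e l) = k l l" if "l \<in> C" for k l
  proof -
    have "?e l \<bullet> opr k (?e l) = (\<Sum>i\<in>C. \<Sum>j\<in>C. if l = j then (if l = i then k i j else 0) else 0)"
      unfolding opr_inner inner_unit_ell2 by (intro sum.cong refl) simp
    also have "\<dots> = k l l" using that C by (simp add: sum.delta')
    finally show ?thesis .
  qed
  have trace: "(\<Sum>x\<in>B. x \<bullet> opr k x) = (\<Sum>i\<in>C. k i i)" for k
    unfolding B_def sum.reindex[OF inj_unit_ell2] by (simp add: opr_diag)
  have sq: "z \<bullet> z = (\<Sum>i\<in>C. (z \<bullet> ?e i)\<^sup>2)" if "z \<in> span B" for z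
    using orthonormal_inner[OF B that, of z]
    unfolding B_def sum.reindex[OF inj_unit_ell2] by (simp add: power2_eq_square)
  obtain X where X: "X \<in> sets borel"
    "emeasure lborel X \<le> ennreal ((\<Sum>x\<in>B. x \<bullet> opr b x) - (\<Sum>x\<in>B. x \<bullet> opr a x))"
    "\<And>x. x \<notin> X \<Longrightarrow> \<exists>\<delta>>0. \<exists>P. linear P \<and> (\<forall>y\<in>span B. P y \<in> span B
      \<and> (x + \<delta>) * (P y \<bullet> P y) \<le> P y \<bullet> opr a (P y)
      \<and> (y - P y) \<bullet> opr b (y - P y) \<le> (x - \<delta>) * ((y - P y) \<bullet> (y - P y)))"
    using ordered_symmetric_pair_splitting[OF B opr_lin opr_lin opr_sym[OF syma] opr_sym[OF symb]
        opr_inv opr_inv, unfolded opr_form, OF _ _ _ _ le]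
    unfolding opr_form by metis
  show thesis
  proof (rule that[OF X(1)])
    show "emeasure lborel X \<le> ennreal (\<Sum>i\<in>C. b i i - a i i)"
      using X(2) by (simp add: trace sum_subtractf)
    fix x assume "x \<notin> X"
    then obtain \<delta> P where d: "\<delta> > 0" and P: "linear P"
      "\<forall>y\<in>span B. P y \<in> span B \<and> (x + \<delta>) * (P y \<bullet> P y) \<le> P y \<bullet> opr a (P y)
      \<and> (y - P y) \<bullet> opr b (y - P y) \<le> (x - \<delta>) * ((y - P y) \<bullet> (y - P y))"
      using X(3) by blast
    show "\<exists>\<delta>>0. \<exists>P::'a \<Rightarrow> 'a \<Rightarrow> real. \<forall>f.
      (x + \<delta>) * (\<Sum>i\<in>C. (\<Sum>j\<in>C. P i j * f j)\<^sup>2) \<le> quadratic_form C a (\<lambda>i. \<Sum>j\<in>C. P i j * f j)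
      \<and> quadratic_form C b (\<lambda>i. f i - (\<Sum>j\<in>C. P i j * f j))
        \<le> (x - \<delta>) * (\<Sum>i\<in>C. (f i - (\<Sum>j\<in>C. P i j * f j))\<^sup>2)"
    \<comment> \<open>The witness is the matrix of the projection in the coordinate basis.\<close>
    proof (intro exI[of _ \<delta>] exI[of _ "\<lambda>i j. P (?e j) \<bullet> ?e i"] conjI allI d)
      fix f :: "'a \<Rightarrow> real"
      define y where "y = (\<Sum>j\<in>C. f j *\<^sub>R ?e j)"
      have y: "y \<in> span B" unfolding y_def by (intro span_sum span_scale eB)
      have ye: "y \<bullet> ?e i = f i" if "i \<in> C" for i
      proof -
        have "y \<bullet> ?e i = (\<Sum>j\<in>C. if j = i then f j else 0)"
          unfolding y_def inner_sum_left by (intro sum.cong refl) (simp add: inner_unit_ell2)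
        then show ?thesis using that C by simp
      qed
      have Py: "P y \<bullet> ?e i = (\<Sum>j\<in>C. (P (?e j) \<bullet> ?e i) * f j)" for i
        using P(1) by (simp add: y_def linear_sum linear_scale inner_sum_left mult.commute)
      have qcong: "quadratic_form C k u = quadratic_form C k v" if "\<And>i. i \<in> C \<Longrightarrow> u i = v i" for k u v
        unfolding quadratic_form_def by (intro sum.cong refl) (simp add: that)
      have PB: "P y \<in> span B" "y - P y \<in> span B" using P(2) y by (auto intro: span_diff)
      show "(x + \<delta>) * (\<Sum>i\<in>C. (\<Sum>j\<in>C. (P (?e j) \<bullet> ?e i) * f j)\<^sup>2)
          \<le> quadratic_form C a (\<lambda>i. \<Sum>j\<in>C. (P (?e j) \<bullet> ?e i) * f j)"
        using bspec[OF P(2) y, unfolded opr_form Py sq[OF PB(1)]] by blast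
      have "(y - P y) \<bullet> opr b (y - P y) \<le> (x - \<delta>) * ((y - P y) \<bullet> (y - P y))"
        using P(2) y by blast
      then show "quadratic_form C b (\<lambda>i. f i - (\<Sum>j\<in>C. (P (?e j) \<bullet> ?e i) * f j))
        \<le> (x - \<delta>) * (\<Sum>i\<in>C. (f i - (\<Sum>j\<in>C. (P (?e j) \<bullet> ?e i) * f j))\<^sup>2)"
        unfolding opr_form sq[OF PB(2)] unfolding inner_diff_left Py
        using qcong[of "\<lambda>i. y \<bullet> ?e i - (\<Sum>j\<in>C. (P (?e j) \<bullet> ?e i) * f j)"
            "\<lambda>i. f i - (\<Sum>j\<in>C. (P (?e j) \<bullet> ?e i) * f j)" b] ye
        by simp
    qed
  qed
qed

subsection \<open>The period cells of the lattice\<close>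

definition cell :: "nat \<Rightarrow> nat \<Rightarrow> (int \<times> int) set" where
  "cell N M = {0..<int N} \<times> {0..<int M}"

definition base_point :: "nat \<Rightarrow> nat \<Rightarrow> int \<times> int \<Rightarrow> int \<times> int" where
  "base_point N M k = (fst k * int N, snd k * int M)"

definition cell_index :: "nat \<Rightarrow> nat \<Rightarrow> int \<times> int \<Rightarrow> int \<times> int" where
  "cell_index N M i = (fst i div int N, snd i div int M)"

definition directions :: "(int \<times> int) set" where
  "directions = {(0, - 1), (0, 1), (- 1, 0), (1, 0)}"

lemma finite_cell [simp]: "finite (cell N M)"
  by (simp add: cell_def)

lemma finite_directions [simp]: "finite directions"
  by (simp add: directions_def)

lemma sum_directions:
  "(\<Sum>d\<in>directions. f d) = f (0, - 1) + f (0, 1) + f (- 1, 0) + f (1, 0)"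
  by (simp add: directions_def add.assoc)

lemma cell_decomposition_bij:
  assumes "N \<ge> 1" "M \<ge> 1"
  shows "bij_betw (\<lambda>(k, c). base_point N M k + c) (UNIV \<times> cell N M) UNIV"
  by (rule bij_betw_byWitness[where f' = "\<lambda>(n, m).
      ((n div int N, m div int M), (n mod int N, m mod int M))"])
    (use assms in \<open>auto simp: base_point_def cell_def\<close>)

text \<open>Summability permits regrouping by cells, so single terms may be negative as long as each
  cell total is not.\<close>

lemma infsum_nonneg_cellwise:
  fixes f :: "int \<times> int \<Rightarrow> real"
  assumes NM: "N \<ge> 1" "M \<ge> 1" and f: "f summable_on UNIV"
    and nonneg: "\<And>k. 0 \<le> (\<Sum>c\<in>cell N M. f (base_point N M k + c))"
  shows "0 \<le> infsum f UNIV"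
proof -
  note bij = cell_decomposition_bij[OF NM]
  have "infsum f UNIV = (\<Sum>\<^sub>\<infinity>(k, c)\<in>UNIV \<times> cell N M. f (base_point N M k + c))"
    using infsum_reindex_bij_betw[OF bij, of f] by (simp add: case_prod_unfold)
  also have "\<dots> = (\<Sum>\<^sub>\<infinity>k. \<Sum>\<^sub>\<infinity>c\<in>cell N M. f (base_point N M k + c))"
    using summable_on_reindex_bij_betw[OF bij, of f] f
    by (intro infsum_Sigma'_banach[symmetric]) (simp add: case_prod_unfold)
  also have "0 \<le> \<dots>"
    by (rule infsum_nonneg) (use nonneg in \<open>simp add: infsum_finite\<close>)
  finally show ?thesis .
qed

text \<open>Links two descriptions of a hop that stays in its cell: equality of cell indices, which
  is symmetric in the endpoints, and membership in the base cell, which suits sums over one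
  cell.\<close>

lemma cell_index_base_point:
  assumes "N \<ge> 1" "M \<ge> 1" "c \<in> cell N M"
  shows "cell_index N M (base_point N M k + c + d) = cell_index N M (base_point N M k + c)
    \<longleftrightarrow> c + d \<in> cell N M"
proof -
  have div: "(a * P + b + e) div P = (a * P + b) div P \<longleftrightarrow> 0 \<le> b + e \<and> b + e < P"
    if "0 \<le> b" "b < P" for a b e P :: int
  proof -
    have "(a * P + b + e) div P = a + (b + e) div P" "(a * P + b) div P = a"
      using that by (simp_all add: add.assoc)
    then show ?thesis
      using that by (auto simp: zdiv_eq_0_iff)
  qed
  show ?thesis
    using assms(3) div[of "fst c" "int N" "fst k" "fst d"] div[of "snd c" "int M" "snd k" "snd d"]
    by (cases k; cases c; cases d) (auto simp: cell_index_def base_point_def cell_def)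
qed

section \<open>The matrix of one cell and its boundary hops\<close>

text \<open>The matrix entries of the operator. Restricting both indices to a cell drops the hops
  that leave it; nothing is wrapped around.\<close>

definition cell_kernel :: "(int \<Rightarrow> int \<Rightarrow> real) \<Rightarrow> int \<times> int \<Rightarrow> int \<times> int \<Rightarrow> real" where
  "cell_kernel q c c' = (if c = c' then q (fst c) (snd c) else 0)
     + (\<Sum>d\<in>directions. if c + d = c' then 1 else 0)"

definition exits :: "nat \<Rightarrow> nat \<Rightarrow> int \<times> int \<Rightarrow> real" where
  "exits N M c = (\<Sum>d\<in>directions. if c + d \<in> cell N M then 0 else 1)"

definition diagonal :: "('a \<Rightarrow> real) \<Rightarrow> 'a \<Rightarrow> 'a \<Rightarrow> real" where
  "diagonal p c c' = (if c = c' then p c else 0)"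

lemma cell_kernel_sym: "cell_kernel q c c' = cell_kernel q c' c"
  by (cases c; cases c') (auto simp: cell_kernel_def sum_directions)

lemma quadratic_form_diagonal:
  assumes "finite C"
  shows "quadratic_form C (diagonal p) f = (\<Sum>c\<in>C. p c * (f c)\<^sup>2)"
proof -
  have "(\<Sum>j\<in>C. diagonal p c j * f c * f j) = p c * (f c)\<^sup>2" if "c \<in> C" for c
  proof -
    have "(\<Sum>j\<in>C. diagonal p c j * f c * f j) = (\<Sum>j\<in>C. if c = j then p c * f c * f j else 0)"
      by (rule sum.cong) (auto simp: diagonal_def)
    then show ?thesis using that assms by (simp add: power2_eq_square)
  qed
  then show ?thesis by (simp add: quadratic_form_def)
qed

lemma quadratic_form_add:
  "quadratic_form C (\<lambda>i j. a i j + b i j) f = quadratic_form C a f + quadratic_form C b f"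
  by (simp add: quadratic_form_def distrib_right sum.distrib)

lemma quadratic_form_diff:
  "quadratic_form C (\<lambda>i j. a i j - b i j) f = quadratic_form C a f - quadratic_form C b f"
  by (simp add: quadratic_form_def left_diff_distrib sum_subtractf)

lemma quadratic_form_cell_kernel:
  assumes "finite C"
  shows "quadratic_form C (cell_kernel q) f = (\<Sum>c\<in>C. q (fst c) (snd c) * (f c)\<^sup>2
    + (\<Sum>d\<in>directions. if c + d \<in> C then f (c + d) * f c else 0))"
proof -
  have "quadratic_form C (cell_kernel q) f
      = quadratic_form C (diagonal (\<lambda>c. q (fst c) (snd c))) f
        + quadratic_form C (\<lambda>c c'. \<Sum>d\<in>directions. if c + d = c' then 1 else 0) f"
    unfolding quadratic_form_add[symmetric]
    by (simp add: quadratic_form_def cell_kernel_def diagonal_def)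
  also have "quadratic_form C (\<lambda>c c'. \<Sum>d\<in>directions. if c + d = c' then 1 else 0) f
      = (\<Sum>c\<in>C. \<Sum>d\<in>directions. if c + d \<in> C then f (c + d) * f c else 0)"
    unfolding quadratic_form_def
  proof (rule sum.cong[OF refl])
    fix c
    have "(\<Sum>j\<in>C. (\<Sum>d\<in>directions. if c + d = j then 1 else 0) * f c * f j)
        = (\<Sum>j\<in>C. \<Sum>d\<in>directions. if c + d = j then f j * f c else 0)"
      unfolding sum_distrib_right by (intro sum.cong refl) simp
    also have "\<dots> = (\<Sum>d\<in>directions. \<Sum>j\<in>C. if c + d = j then f j * f c else 0)"
      by (rule sum.swap)
    also have "\<dots> = (\<Sum>d\<in>directions. if c + d \<in> C then f (c + d) * f c else 0)"
      using assms by (intro sum.cong refl) (simp add: sum.delta')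
    finally show "(\<Sum>j\<in>C. (\<Sum>d\<in>directions. if c + d = j then 1 else 0) * f c * f j)
        = (\<Sum>d\<in>directions. if c + d \<in> C then f (c + d) * f c else 0)" .
  qed
  finally show ?thesis
    by (simp add: quadratic_form_diagonal[OF assms] sum.distrib)
qed

text \<open>For each direction, the sites whose hop leaves the cell form one side: two sides have
  \<open>N\<close> sites and two have \<open>M\<close>. Sides are counted per direction, so widths
  equal to 1 fit the same count.\<close>

lemma sum_exits:
  assumes "N \<ge> 1" "M \<ge> 1"
  shows "(\<Sum>c\<in>cell N M. exits N M c) = 2 * (real N + real M)"
proof -
  have count: "(\<Sum>c\<in>cell N M. if c + d \<in> cell N M then 0 else 1) = real (card {c\<in>cell N M. c + d \<notin> cell N M})"
    for d
  proof -
    have "(\<Sum>c\<in>cell N M. if c + d \<in> cell N M then 0 else 1)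
        = (\<Sum>c\<in>cell N M. if c + d \<notin> cell N M then 1 else (0::real))"
      by (rule sum.cong) auto
    then show ?thesis by (simp add: sum.If_cases Int_def)
  qed
  have "{c\<in>cell N M. c + (0, - 1) \<notin> cell N M} = {0..<int N} \<times> {0}"
    "{c\<in>cell N M. c + (0, 1) \<notin> cell N M} = {0..<int N} \<times> {int M - 1}"
    "{c\<in>cell N M. c + (- 1, 0) \<notin> cell N M} = {0} \<times> {0..<int M}"
    "{c\<in>cell N M. c + (1, 0) \<notin> cell N M} = {int N - 1} \<times> {0..<int M}"
    using assms by (auto simp: cell_def)
  then show ?thesis
    unfolding exits_def by (subst sum.swap) (simp add: count sum_directions card_cartesian_product)
qed

section \<open>The form of the operator, estimated cell by cell\<close>

lemma bij_add_right: "bij (\<lambda>i::int \<times> int. i + d)"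
  by (rule bij_betw_byWitness[where f' = "\<lambda>i. i - d"]) auto

lemma periodic_base_point:
  fixes q :: "int \<Rightarrow> int \<Rightarrow> real"
  assumes "\<And>n m. q (n + int N) m = q n m" "\<And>n m. q n (m + int M) = q n m"
  shows "q (fst (base_point N M k + c)) (snd (base_point N M k + c)) = q (fst c) (snd c)"
proof -
  have per: "f (a * p + b) = f b" if f: "\<And>n. f (n + p) = f n" for f :: "int \<Rightarrow> real" and a b p
  proof (induction a rule: int_induct[where k = 0])
    case (step1 i)
    then show ?case using f[of "i * p + b"] by (simp add: algebra_simps)
  next
    case (step2 i)
    then show ?case using f[of "(i - 1) * p + b"] by (simp add: algebra_simps)
  qed simp
  have "q (fst k * int N + fst c) (snd k * int M + snd c) = q (fst c) (snd k * int M + snd c)"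
    by (rule per[of "\<lambda>n. q n (snd k * int M + snd c)"]) (rule assms)
  also have "\<dots> = q (fst c) (snd c)"
    by (rule per) (rule assms)
  finally show ?thesis by (simp add: base_point_def)
qed

lemma schroedinger_apply_directions:
  assumes "\<And>n m. \<bar>q n m\<bar> \<le> B"
  shows "Rep_ell2 (schroedinger q y) i
    = (\<Sum>d\<in>directions. Rep_ell2 y (i + d)) + complex_of_real (q (fst i) (snd i)) * Rep_ell2 y i"
  by (cases i) (simp add: schroedinger_apply[OF assms] sum_directions)

lemma has_sum_diff_real:
  fixes f g :: "'a \<Rightarrow> real"
  assumes "(f has_sum a) A" "(g has_sum b) A"
  shows "((\<lambda>x. f x - g x) has_sum (a - b)) A"
  using has_sum_add[OF assms(1), of "\<lambda>x. - g x" "- b"] assms(2) by (simp add: has_sum_uminus)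

lemma has_sum_finite_sum:
  fixes f :: "'i \<Rightarrow> 'a \<Rightarrow> real"
  assumes "finite I" "\<And>i. i \<in> I \<Longrightarrow> (f i has_sum a i) A"
  shows "((\<lambda>x. \<Sum>i\<in>I. f i x) has_sum (\<Sum>i\<in>I. a i)) A"
  using assms by (induction I) (auto intro: has_sum_add)

text \<open>A hop across a cell boundary contributes at least \<open>-(cmod Y(i+d)\<^sup>2 + cmod Y(i)\<^sup>2) / 2\<close>; summed
  over all hops, this replaces the boundary hops by the diagonal term \<open>exits\<close>.\<close>

lemma schroedinger_form_lower:
  fixes y :: "(int \<times> int) ell2"
  assumes NM: "N \<ge> 1" "M \<ge> 1"
    and per: "\<And>n m. q (n + int N) m = q n m" "\<And>n m. q n (m + int M) = q n m"
    and B: "\<And>n m. \<bar>q n m\<bar> \<le> B" and s: "\<bar>s\<bar> = 1"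
    and cellwise: "\<And>k p. p \<in> {Re, Im} \<Longrightarrow>
      \<mu> * (\<Sum>c\<in>cell N M. (p (Rep_ell2 y (base_point N M k + c)))\<^sup>2)
      \<le> s * quadratic_form (cell N M) (cell_kernel q) (\<lambda>c. p (Rep_ell2 y (base_point N M k + c)))
        - (\<Sum>c\<in>cell N M. exits N M c * (p (Rep_ell2 y (base_point N M k + c)))\<^sup>2)"
  shows "\<mu> * (y \<bullet> y) \<le> s * (schroedinger q y \<bullet> y)"
proof -
  let ?C = "cell N M"
  define Y where "Y = Rep_ell2 y"
  define Z where "Z = Rep_ell2 (schroedinger q y)"
  define out where "out d i \<longleftrightarrow> cell_index N M (i + d) \<noteq> cell_index N M i" for d i
  \<comment> \<open>For a boundary hop, \<open>u\<close> holds half the mass of the far endpoint and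
    \<open>v\<close> half that of the near one. Translating by \<open>d\<close> turns
    \<open>u d\<close> into \<open>v (- d)\<close>, since crossing a boundary is symmetric.\<close>
  define u v where "u d i = (if out d i then (cmod (Y (i + d)))\<^sup>2 / 2 else 0)"
    and "v d i = (if out d i then (cmod (Y i))\<^sup>2 / 2 else 0)" for d i
  have Ysum: "(\<lambda>i. (cmod (Y i))\<^sup>2) summable_on UNIV"
    using sq_summable_Rep_ell2[of y] by (simp add: sq_summable_def Y_def)
  have vsum: "v d summable_on UNIV" for d
    by (rule summable_on_comparison_test[OF Ysum]) (auto simp: v_def)
  have uv: "u d = (\<lambda>i. v (- d) (i + d))" for d
    by (auto simp: u_def v_def out_def fun_eq_iff)
  have usum: "u d summable_on UNIV" for d
    unfolding uv using summable_on_reindex_bij_betw[OF bij_add_right[of d], of "v (- d)"] vsum by simp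
  have uinf: "infsum (u d) UNIV = infsum (v (- d)) UNIV" for d
    unfolding uv by (rule infsum_reindex_bij_betw[OF bij_add_right])
  have ZY: "(\<lambda>i. Z i \<bullet> Y i) summable_on UNIV"
    unfolding Z_def Y_def by (intro sq_summable_inner sq_summable_Rep_ell2)
  have YY: "(\<lambda>i. Y i \<bullet> Y i) summable_on UNIV"
    unfolding Y_def by (intro sq_summable_inner sq_summable_Rep_ell2)
  \<comment> \<open>The added terms sum to zero over the lattice, as the directions come in opposite
    pairs. Locally they trade the far endpoint, which lies in another cell, for the near
    one.\<close>
  define F where "F i = (s * (Z i \<bullet> Y i) - \<mu> * (Y i \<bullet> Y i)) + (\<Sum>d\<in>directions. u d i - v d i)" for i
  have "((\<lambda>i. Z i \<bullet> Y i) has_sum (schroedinger q y \<bullet> y)) UNIV"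
    using has_sum_infsum[OF ZY] unfolding inner_ell2_eq Z_def Y_def .
  moreover have "((\<lambda>i. Y i \<bullet> Y i) has_sum (y \<bullet> y)) UNIV"
    using has_sum_infsum[OF YY] unfolding inner_ell2_eq Y_def .
  ultimately have "(F has_sum ((s * (schroedinger q y \<bullet> y) - \<mu> * (y \<bullet> y))
      + (\<Sum>d\<in>directions. infsum (u d) UNIV - infsum (v d) UNIV))) UNIV"
    unfolding F_def
    by (intro has_sum_add has_sum_diff_real has_sum_finite_sum has_sum_cmult_right
        has_sum_infsum usum vsum finite_directions)
  moreover have "(\<Sum>d\<in>directions. infsum (u d) UNIV - infsum (v d) UNIV) = 0"
    unfolding uinf by (simp add: sum_directions)
  ultimately have HF: "(F has_sum (s * (schroedinger q y \<bullet> y) - \<mu> * (y \<bullet> y))) UNIV"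
    by simp
  have "0 \<le> infsum F UNIV"
  proof (rule infsum_nonneg_cellwise[OF NM])
    show "F summable_on UNIV" using HF by (rule has_sum_imp_summable)
    fix k
    let ?b = "base_point N M k"
    let ?f = "\<lambda>p c. p (Y (?b + c)) :: real"
    \<comment> \<open>The cellwise hypothesis as a sum over sites, for the real or the imaginary
      part separately; the two parts together will bound \<open>F\<close> from below.\<close>
    define G where "G p c = s * (q (fst c) (snd c) * (?f p c)\<^sup>2
        + (\<Sum>d\<in>directions. if c + d \<in> ?C then ?f p (c + d) * ?f p c else 0))
        - exits N M c * (?f p c)\<^sup>2 - \<mu> * (?f p c)\<^sup>2" for p c
    have G: "0 \<le> (\<Sum>c\<in>?C. G p c)" if "p \<in> {Re, Im}" for p
      using cellwise[OF that, of k, folded Y_def]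
      by (simp add: G_def sum_subtractf sum_distrib_left[symmetric] quadratic_form_cell_kernel add.assoc)
    have "G Re c + G Im c \<le> F (?b + c)" if c: "c \<in> ?C" for c
    proof -
      let ?i = "?b + c"
      have out: "out d ?i \<longleftrightarrow> c + d \<notin> ?C" for d
        using cell_index_base_point[OF NM c] by (simp add: out_def)
      \<comment> \<open>For a boundary hop the product is at least minus half the sum of both
        masses. Adding \<open>u - v\<close> cancels the far half and doubles the near one, leaving
        exactly \<open>- (Y ?i \<bullet> Y ?i)\<close>.\<close>
      have hop: "s * (if c + d \<in> ?C then Y (?i + d) \<bullet> Y ?i else 0) - (if c + d \<in> ?C then 0 else Y ?i \<bullet> Y ?i)
          \<le> s * (Y (?i + d) \<bullet> Y ?i) + (u d ?i - v d ?i)" for d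
      proof (cases "c + d \<in> ?C")
        case False
        have "\<bar>s * (Y (?i + d) \<bullet> Y ?i)\<bar> \<le> cmod (Y (?i + d)) * cmod (Y ?i)"
          using s by (simp add: abs_mult Cauchy_Schwarz_ineq2)
        moreover have "2 * (cmod (Y (?i + d)) * cmod (Y ?i)) \<le> (cmod (Y (?i + d)))\<^sup>2 + (cmod (Y ?i))\<^sup>2"
          using sum_squares_bound[of "cmod (Y (?i + d))" "cmod (Y ?i)"] by simp
        moreover have "Y ?i \<bullet> Y ?i = (cmod (Y ?i))\<^sup>2" by (rule dot_square_norm)
        ultimately show ?thesis
          using False by (simp add: u_def v_def out)
      qed (simp add: u_def v_def out)
      have "G Re c + G Im c = s * (q (fst c) (snd c) * (Y ?i \<bullet> Y ?i)) - \<mu> * (Y ?i \<bullet> Y ?i)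
          + (\<Sum>d\<in>directions. s * (if c + d \<in> ?C then Y (?i + d) \<bullet> Y ?i else 0)
            - (if c + d \<in> ?C then 0 else Y ?i \<bullet> Y ?i))"
      proof -
        have "(\<Sum>d\<in>directions. if c + d \<in> ?C then Y (?i + d) \<bullet> Y ?i else 0)
            = (\<Sum>d\<in>directions. if c + d \<in> ?C then ?f Re (c + d) * ?f Re c else 0)
            + (\<Sum>d\<in>directions. if c + d \<in> ?C then ?f Im (c + d) * ?f Im c else 0)"
          unfolding sum.distrib[symmetric]
          by (intro sum.cong refl) (simp add: inner_complex_def add.assoc)
        moreover have "(\<Sum>d\<in>directions. if c + d \<in> ?C then 0 else Y ?i \<bullet> Y ?i)
            = exits N M c * (Y ?i \<bullet> Y ?i)"
          unfolding exits_def sum_distrib_right by (intro sum.cong refl) simp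
        moreover have "Y ?i \<bullet> Y ?i = (?f Re c)\<^sup>2 + (?f Im c)\<^sup>2"
          by (simp add: inner_complex_def power2_eq_square)
        ultimately show ?thesis
          by (simp add: G_def sum_subtractf sum_distrib_left[symmetric] distrib_left distrib_right)
      qed
      also have "\<dots> \<le> s * (q (fst c) (snd c) * (Y ?i \<bullet> Y ?i)) - \<mu> * (Y ?i \<bullet> Y ?i)
          + (\<Sum>d\<in>directions. s * (Y (?i + d) \<bullet> Y ?i) + (u d ?i - v d ?i))"
        by (intro add_left_mono sum_mono hop)
      also have "\<dots> = F ?i"
      proof -
        have "Z ?i = (\<Sum>d\<in>directions. Y (?i + d)) + complex_of_real (q (fst c) (snd c)) * Y ?i"
          unfolding Z_def Y_def schroedinger_apply_directions[OF B]
          using periodic_base_point[where N = N and M = M and q = q, OF per, of k c] by simp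
        then have "Z ?i \<bullet> Y ?i = (\<Sum>d\<in>directions. Y (?i + d) \<bullet> Y ?i) + q (fst c) (snd c) * (Y ?i \<bullet> Y ?i)"
          by (simp add: inner_add_left inner_sum_left scaleR_conv_of_real[symmetric])
        then show ?thesis
          by (simp add: F_def sum.distrib sum_distrib_left[symmetric] distrib_left)
      qed
      finally show ?thesis .
    qed
    then have "(\<Sum>c\<in>?C. G Re c + G Im c) \<le> (\<Sum>c\<in>?C. F (?b + c))"
      by (rule sum_mono)
    then show "0 \<le> (\<Sum>c\<in>?C. F (?b + c))"
      using G[of Re] G[of Im] by (simp add: sum.distrib)
  qed
  then show ?thesis using infsumI[OF HF] by simp
qed

section \<open>From a lower bound to the resolvent set\<close>

text \<open>The nonreal point \<open>z\<close> at distance \<open>k / 3\<close> above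
  \<open>x\<close> is in the resolvent set. The lower bound at \<open>x\<close> becomes
  \<open>2 * k / 3\<close> at \<open>z\<close>, so the inverse there has norm at most
  \<open>3 / (2 * k)\<close>. Its product with the distance is 1/2, and the perturbation result
  reaches \<open>x\<close>.\<close>

lemma bounded_below_not_in_spectrum:
  assumes T: "bounded_clinear T" and real: "spectrum T \<subseteq> \<real>"
    and k: "0 < k" "\<And>u. k * norm u \<le> norm (T u - x *\<^sub>R u)"
  shows "complex_of_real x \<notin> spectrum T"
proof -
  define z where "z = Complex x (k / 3)"
  have "z \<notin> \<real>" using k(1) by (simp add: z_def complex_is_Real_iff)
  then have "z \<in> resolvent_set T" using real by (auto simp: spectrum_def)
  then obtain R where R: "bounded_clinear R" "\<And>x. R (T x - scale_ell2 z x) = x"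
    "\<And>y. T (R y) - scale_ell2 z (R y) = y"
    by (auto simp: resolvent_set_def)
  have "norm (R y) \<le> 3 / (2 * k) * norm y" for y
  proof -
    let ?u = "R y"
    have "z = complex_of_real x + \<i> * complex_of_real (k / 3)"
      by (simp add: z_def complex_eq_iff)
    then have "T ?u - x *\<^sub>R ?u = y + scale_ell2 (\<i> * complex_of_real (k / 3)) ?u"
      using R(3)[of y] by (simp add: scale_ell2_simps algebra_simps)
    then have "norm (T ?u - x *\<^sub>R ?u) \<le> norm y + norm (scale_ell2 (\<i> * complex_of_real (k / 3)) ?u)"
      by (metis norm_triangle_ineq)
    also have "norm (scale_ell2 (\<i> * complex_of_real (k / 3)) ?u) = k / 3 * norm ?u"
      unfolding norm_scale_ell2 using k(1) by (simp add: norm_mult)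
    finally have "k * norm ?u \<le> norm y + k / 3 * norm ?u"
      using k(2)[of ?u] by linarith
    then show ?thesis using k(1) by (simp add: field_simps)
  qed
  moreover have "cmod (complex_of_real x - z) * (3 / (2 * k)) < 1"
  proof -
    have "complex_of_real x - z = - (\<i> * complex_of_real (k / 3))"
      by (simp add: z_def complex_eq_iff)
    then have "cmod (complex_of_real x - z) = k / 3"
      using k(1) by (simp add: norm_mult)
    then show ?thesis using k(1) by simp
  qed
  ultimately have "complex_of_real x \<in> resolvent_set T"
    using resolvent_set_perturb[OF T R, of "3 / (2 * k)" "complex_of_real x"] k(1) by simp
  then show ?thesis by (simp add: spectrum_def)
qed

section \<open>Applying one matrix in every cell\<close>

lemma sq_summable_sum:
  assumes "finite A" "\<And>a. a \<in> A \<Longrightarrow> sq_summable (f a)"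
  shows "sq_summable (\<lambda>i. \<Sum>a\<in>A. f a i)"
  using assms by (induction A) (auto simp: sq_summable_0 sq_summable_add)

lemma cellwise_operator_exists:
  fixes P :: "int \<times> int \<Rightarrow> int \<times> int \<Rightarrow> real" and u :: "(int \<times> int) ell2"
  assumes NM: "N \<ge> 1" "M \<ge> 1"
  obtains w :: "(int \<times> int) ell2" where "\<And>k c. c \<in> cell N M \<Longrightarrow>
    Rep_ell2 w (base_point N M k + c)
      = (\<Sum>c'\<in>cell N M. complex_of_real (P c c') * Rep_ell2 u (base_point N M k + c'))"
proof -
  let ?C = "cell N M"
  define pos where "pos i = (fst i mod int N, snd i mod int M)" for i
  \<comment> \<open>Writing the block action as a finite sum of bounded multiples of translates of
    \<open>u\<close> makes it square summable. \<open>pos\<close> selects the row \<open>e\<close>,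
    and the shift by \<open>c - e\<close> moves from position \<open>e\<close> to position
    \<open>c\<close> of the same cell.\<close>
  define W where "W i = (\<Sum>e\<in>?C. \<Sum>c\<in>?C.
    (if pos i = e then complex_of_real (P e c) else 0) * Rep_ell2 u (i + (c - e)))" for i
  have "sq_summable W"
    unfolding W_def
  proof (intro sq_summable_sum finite_cell)
    fix e c
    show "sq_summable (\<lambda>i. (if pos i = e then complex_of_real (P e c) else 0) * Rep_ell2 u (i + (c - e)))"
      by (rule sq_summable_bounded_mult[where B = "\<bar>P e c\<bar>"])
        (auto intro: sq_summable_reindex sq_summable_Rep_ell2 bij_add_right)
  qed
  then have RepW: "Rep_ell2 (Abs_ell2 W) = W"
    by (simp add: Abs_ell2_inverse)
  have "W (base_point N M k + c) = (\<Sum>c'\<in>?C. complex_of_real (P c c') * Rep_ell2 u (base_point N M k + c'))"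
    if c: "c \<in> ?C" for k c
  proof -
    have "pos (base_point N M k + c) = c"
      using c by (auto simp: pos_def base_point_def cell_def)
    then have "W (base_point N M k + c) = (\<Sum>e\<in>?C. if c = e then
        (\<Sum>c'\<in>?C. complex_of_real (P e c') * Rep_ell2 u (base_point N M k + c + (c' - e))) else 0)"
      unfolding W_def by (intro sum.cong refl) simp
    then show ?thesis using c by (simp add: sum.delta')
  qed
  then show thesis using that[of "Abs_ell2 W"] by (simp add: RepW)
qed

section \<open>The spectrum inside the exceptional set\<close>

theorem theorem1p3:
  fixes N M :: nat and q :: "int \<Rightarrow> int \<Rightarrow> real"
  assumes "N \<ge> 1" and "M \<ge> 1"
    and "\<And>n m. q (n + int N) m = q n m"
    and "\<And>n m. q n (m + int M) = q n m"
  shows "emeasure lebesgue {x :: real. complex_of_real x \<in> spectrum (schroedinger q)}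
           \<le> ennreal (4 * (real N + real M))"
proof -
  let ?C = "cell N M" and ?E = "diagonal (exits N M)" and ?H = "schroedinger q"
  obtain B where B: "\<And>n m. \<bar>q n m\<bar> \<le> B"
    using periodic_bounded[where N = N and M = M and q = q, OF assms] by blast
  interpret H: bounded_linear ?H
    using bounded_clinear_schroedinger[OF B] by (simp add: bounded_clinear_def)
  \<comment> \<open>The blocks of the lower and the upper operator. They differ by twice the
    diagonal of \<open>exits\<close>, whose trace is \<open>2 * (N + M)\<close>.\<close>
  define a b where "a = (\<lambda>c c'. cell_kernel q c c' - ?E c c')"
    and "b = (\<lambda>c c'. cell_kernel q c c' + ?E c c')"
  have exits_nonneg: "0 \<le> exits N M c" for c
    by (auto simp: exits_def intro: sum_nonneg)
  have forms: "quadratic_form ?C a f = quadratic_form ?C (cell_kernel q) f - (\<Sum>c\<in>?C. exits N M c * (f c)\<^sup>2)"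
    "quadratic_form ?C b f = quadratic_form ?C (cell_kernel q) f + (\<Sum>c\<in>?C. exits N M c * (f c)\<^sup>2)" for f
    by (simp_all add: a_def b_def quadratic_form_add quadratic_form_diff quadratic_form_diagonal)
  have le: "quadratic_form ?C a f \<le> quadratic_form ?C b f" for f
  proof -
    have "0 \<le> (\<Sum>c\<in>?C. exits N M c * (f c)\<^sup>2)"
      by (intro sum_nonneg mult_nonneg_nonneg exits_nonneg) simp
    then show ?thesis by (simp add: forms)
  qed
  have sym: "a i j = a j i" "b i j = b j i" for i j
    using cell_kernel_sym[of q i j] by (auto simp: a_def b_def diagonal_def)
  have tr: "(\<Sum>c\<in>?C. b c c - a c c) = 4 * (real N + real M)"
  proof -
    have "(\<Sum>c\<in>?C. b c c - a c c) = 2 * (\<Sum>c\<in>?C. exits N M c)"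
      unfolding sum_distrib_left by (simp add: a_def b_def diagonal_def)
    then show ?thesis using sum_exits[OF assms(1,2)] by simp
  qed
  obtain X where X: "X \<in> sets borel" "emeasure lborel X \<le> ennreal (4 * (real N + real M))"
    and split: "\<And>x. x \<notin> X \<Longrightarrow> \<exists>\<delta>>0. \<exists>P. \<forall>f.
      (x + \<delta>) * (\<Sum>i\<in>?C. (\<Sum>j\<in>?C. P i j * f j)\<^sup>2) \<le> quadratic_form ?C a (\<lambda>i. \<Sum>j\<in>?C. P i j * f j)
      \<and> quadratic_form ?C b (\<lambda>i. f i - (\<Sum>j\<in>?C. P i j * f j))
        \<le> (x - \<delta>) * (\<Sum>i\<in>?C. (f i - (\<Sum>j\<in>?C. P i j * f j))\<^sup>2)"
  proof (rule ordered_kernel_pair_splitting[OF finite_cell sym(1) sym(2) le, unfolded tr], goal_cases)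
    case prems: (1 X)
    show thesis by (rule prems(1)[OF prems(2-4)])
  qed
  have "complex_of_real x \<notin> spectrum ?H" if x: "x \<notin> X" for x
  proof -
    obtain \<delta> P where d: "\<delta> > 0" and P: "\<And>f. (x + \<delta>) * (\<Sum>i\<in>?C. (\<Sum>j\<in>?C. P i j * f j)\<^sup>2)
        \<le> quadratic_form ?C a (\<lambda>i. \<Sum>j\<in>?C. P i j * f j)"
      "\<And>f. quadratic_form ?C b (\<lambda>i. f i - (\<Sum>j\<in>?C. P i j * f j))
        \<le> (x - \<delta>) * (\<Sum>i\<in>?C. (f i - (\<Sum>j\<in>?C. P i j * f j))\<^sup>2)"
      using split[OF x] by blast
    have "\<delta> / 2 * norm u \<le> norm (?H u - x *\<^sub>R u)" for u
    proof -
      obtain w where w: "\<And>k c. c \<in> ?C \<Longrightarrow> Rep_ell2 w (base_point N M k + c)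
          = (\<Sum>c'\<in>?C. complex_of_real (P c c') * Rep_ell2 u (base_point N M k + c'))"
        using cellwise_operator_exists[OF assms(1,2)] by blast
      define v where "v = u - w"
      \<comment> \<open>\<open>P\<close> has real entries, so it commutes with taking real and
        imaginary parts.\<close>
      have wp: "p (Rep_ell2 w (base_point N M k + c)) = (\<Sum>c'\<in>?C. P c c' * p (Rep_ell2 u (base_point N M k + c')))"
        "p (Rep_ell2 v (base_point N M k + c)) = p (Rep_ell2 u (base_point N M k + c))
          - (\<Sum>c'\<in>?C. P c c' * p (Rep_ell2 u (base_point N M k + c')))"
        if "p \<in> {Re, Im}" "c \<in> ?C" for p k c
        using that by (auto simp: w v_def minus_ell2.rep_eq)
      have qcong: "quadratic_form ?C k f = quadratic_form ?C k g" if "\<And>c. c \<in> ?C \<Longrightarrow> f c = g c" for k f g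
        unfolding quadratic_form_def by (intro sum.cong refl) (simp add: that)
      have Tw: "(x + \<delta>) * (w \<bullet> w) \<le> 1 * (?H w \<bullet> w)"
      proof (rule schroedinger_form_lower[where N = N and M = M and q = q, OF assms B])
        fix k and p :: "complex \<Rightarrow> real" assume p: "p \<in> {Re, Im}"
        let ?g = "\<lambda>c. p (Rep_ell2 w (base_point N M k + c))"
        have "(x + \<delta>) * (\<Sum>c\<in>?C. (?g c)\<^sup>2) \<le> quadratic_form ?C a ?g"
          using P(1)[of "\<lambda>c. p (Rep_ell2 u (base_point N M k + c))"]
            qcong[where k = a, OF wp(1)[where k = k, OF p]] by (simp add: wp(1)[OF p])
        then show "(x + \<delta>) * (\<Sum>c\<in>?C. (?g c)\<^sup>2) \<le> 1 * quadratic_form ?C (cell_kernel q) ?g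
            - (\<Sum>c\<in>?C. exits N M c * (?g c)\<^sup>2)"
          by (simp add: forms)
      qed simp
      \<comment> \<open>The upper bound on \<open>v\<close> is the lower form estimate with sign
        \<open>- 1\<close>, fed by the kernel \<open>b\<close>.\<close>
      have Tv: "(\<delta> - x) * (v \<bullet> v) \<le> - 1 * (?H v \<bullet> v)"
      proof (rule schroedinger_form_lower[where N = N and M = M and q = q, OF assms B])
        fix k and p :: "complex \<Rightarrow> real" assume p: "p \<in> {Re, Im}"
        let ?g = "\<lambda>c. p (Rep_ell2 v (base_point N M k + c))"
        have "quadratic_form ?C b ?g \<le> (x - \<delta>) * (\<Sum>c\<in>?C. (?g c)\<^sup>2)"
          using P(2)[of "\<lambda>c. p (Rep_ell2 u (base_point N M k + c))"]
            qcong[where k = b, OF wp(2)[where k = k, OF p]] by (simp add: wp(2)[OF p])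
        then show "(\<delta> - x) * (\<Sum>c\<in>?C. (?g c)\<^sup>2) \<le> - 1 * quadratic_form ?C (cell_kernel q) ?g
            - (\<Sum>c\<in>?C. exits N M c * (?g c)\<^sup>2)"
          by (simp add: forms left_diff_distrib)
      qed simp
      let ?t = "norm w + norm v" and ?T = "?H u - x *\<^sub>R u"
      have u: "u = w + v" by (simp add: v_def)
      \<comment> \<open>The mixed terms cancel when testing against \<open>w - v\<close>, so both
        remaining terms contribute positively.\<close>
      have "?H v \<bullet> w = ?H w \<bullet> v"
        using schroedinger_symmetric[where x = v and y = w, OF B] by (simp add: inner_commute)
      then have "?T \<bullet> (w - v) = (?H w \<bullet> w - x * (w \<bullet> w)) - (?H v \<bullet> v - x * (v \<bullet> v))"
        unfolding u by (simp add: H.add inner_add_left inner_diff_left inner_diff_right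
            inner_commute[of v w] algebra_simps)
      then have "\<delta> * (w \<bullet> w + v \<bullet> v) \<le> ?T \<bullet> (w - v)"
        using Tw Tv by (simp add: algebra_simps)
      also have "\<dots> \<le> norm ?T * norm (w - v)"
        by (rule norm_cauchy_schwarz)
      also have "\<dots> \<le> norm ?T * ?t"
        by (intro mult_left_mono norm_triangle_ineq4) simp
      finally have 1: "\<delta> * ((norm w)\<^sup>2 + (norm v)\<^sup>2) \<le> norm ?T * ?t"
        by (simp add: power2_norm_eq_inner)
      \<comment> \<open>\<open>w\<close> and \<open>v\<close> need not be orthogonal, so
        \<open>norm u\<close> is controlled through \<open>norm w + norm v\<close>; this costs the
        factor 1/2 in the bound.\<close>
      have "?t\<^sup>2 / 2 \<le> (norm w)\<^sup>2 + (norm v)\<^sup>2"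
        using sum_squares_bound[of "norm w" "norm v"] by (simp add: power2_sum)
      then have "\<delta> * (?t\<^sup>2 / 2) \<le> \<delta> * ((norm w)\<^sup>2 + (norm v)\<^sup>2)"
        using d by (intro mult_left_mono) auto
      with 1 have 2: "(\<delta> / 2 * ?t) * ?t \<le> norm ?T * ?t"
        by (simp add: power2_eq_square)
      have "\<delta> / 2 * ?t \<le> norm ?T"
      proof (cases "?t = 0")
        case False
        then have "0 < ?t" by (simp add: less_le)
        then show ?thesis using 2 by (rule mult_right_le_imp_le[rotated])
      qed simp
      moreover have "\<delta> / 2 * norm u \<le> \<delta> / 2 * ?t"
        using d norm_triangle_ineq[of w v] by (intro mult_left_mono) (simp_all add: u)
      ultimately show ?thesis by linarith
    qed
    with d show ?thesis
      by (intro bounded_below_not_in_spectrum[where k = "\<delta> / 2"] bounded_clinear_schroedinger[OF B]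
          spectrum_schroedinger(1)[OF B]) auto
  qed
  then have "{x. complex_of_real x \<in> spectrum ?H} \<subseteq> X" by blast
  then have "emeasure lebesgue {x. complex_of_real x \<in> spectrum ?H} \<le> emeasure lebesgue X"
    using X(1) by (intro emeasure_mono) auto
  also have "\<dots> = emeasure lborel X" using X(1) by simp
  finally show ?thesis using X(2) by (rule order_trans)
qed

end
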